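(* Let $u\in H^2(S^1)$ with $u>0$. If $u$ satisfies $$\int_0^{2\pi}\frac{\cos^{3}(\theta+\alpha)}{u^{5/3}(\theta)}\,d\theta=0\qquad\text{for all }\alpha\in[0,2\pi),$$ then $$\int_0^{2\pi}\big(u_{\theta\theta}^2-10u_\theta^2+9u^2\big)\,d\theta\;\left(\int_0^{2\pi}u^{-2/3}(\theta)\,d\theta\right)^3\ge 144\pi^4 .$$ Moreover, if $u_0$ is an extremal function (that is, $u_0\in H^2(S^1)$, $u_0>0$, $u_0$ satisfies $\int_0^{2\pi}\cos^{3}(\theta+\alpha)\,u_0^{-5/3}(\theta)\,d\theta=0$ for all $\alpha\in[0,2\pi)$, and $\int_0^{2\pi}\big((u_0)_{\theta\theta}^2-10(u_0)_\theta^2+9u_0^2\big)\,d\theta\,\left(\int_0^{2\pi}u_0^{-2/3}(\theta)\,d\theta\right)^3=144\pi^4$), then the $1$-$Q$-curvature of the metric $u_0^{-4/3}g_s$ is a constant, and $$u_0(\theta)=c\left(\lambda^2\cos^2(\theta-\beta)+\lambda^{-2}\sin^2(\theta-\beta)\right)^{3/2}$$ for some $\lambda,c>0$ and $\beta\in[0,2\pi)$.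
   Context: $S^1=\mathbb{R}/2\pi\mathbb{Z}$ with coordinate $\theta$ and standard metric $g_s=d\theta\otimes d\theta$. For a metric $g=v^{-4/3}g_s$ with $v>0$, its $1$-$Q$-curvature is $$Q_g=v^{5/3}\Big(\tfrac{1}{9}v_{\theta\theta\theta\theta}+\tfrac{10}{9}v_{\theta\theta}+v\Big).$$ *)

theory Defs
  imports "HOL-Analysis.Analysis"
begin

text \<open>Functions on the circle \<open>S\<^sup>1 = \<real> / 2\<pi>\<int>\<close> are represented by \<open>2\<pi>\<close>-periodic functions
  on the real line.\<close>

definition circle_fun :: "(real \<Rightarrow> real) \<Rightarrow> bool" where
  "circle_fun f \<longleftrightarrow> (\<forall>\<theta>. f (\<theta> + 2 * pi) = f \<theta>)"

definition smooth_circle :: "(real \<Rightarrow> real) \<Rightarrow> bool" where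
  "smooth_circle f \<longleftrightarrow> circle_fun f \<and> (\<forall>k \<theta>. ((deriv ^^ k) f) differentiable (at \<theta>))"

definition L1_circle :: "(real \<Rightarrow> real) \<Rightarrow> bool" where
  "L1_circle f \<longleftrightarrow> circle_fun f \<and> f \<in> borel_measurable borel \<and>
     set_integrable lborel {0..2 * pi} f"

definition L2_circle :: "(real \<Rightarrow> real) \<Rightarrow> bool" where
  "L2_circle f \<longleftrightarrow> circle_fun f \<and> f \<in> borel_measurable borel \<and>
     set_integrable lborel {0..2 * pi} (\<lambda>\<theta>. (f \<theta>)\<^sup>2)"

text \<open>Weak (distributional) derivative of order \<open>k\<close> on the circle.\<close>

definition has_weak_deriv :: "nat \<Rightarrow> (real \<Rightarrow> real) \<Rightarrow> (real \<Rightarrow> real) \<Rightarrow> bool" where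
  "has_weak_deriv k f g \<longleftrightarrow> L1_circle f \<and> L1_circle g \<and>
     (\<forall>\<phi>. smooth_circle \<phi> \<longrightarrow>
        (LBINT \<theta>:{0..2 * pi}. f \<theta> * (deriv ^^ k) \<phi> \<theta>) =
        (- 1) ^ k * (LBINT \<theta>:{0..2 * pi}. g \<theta> * \<phi> \<theta>))"

text \<open>A weak derivative is unique up to a null set, so integrals of \<open>weak_deriv k f\<close> do not
  depend on the choice made here.\<close>

definition weak_deriv :: "nat \<Rightarrow> (real \<Rightarrow> real) \<Rightarrow> real \<Rightarrow> real" where
  "weak_deriv k f = (SOME g. has_weak_deriv k f g)"

text \<open>Every class in \<open>H\<^sup>2(S\<^sup>1)\<close> has exactly one continuous representative.
  An element of the space is identified with it, so that pointwise statements such as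
  \<open>u > 0\<close> make sense.\<close>

definition H2_circle :: "(real \<Rightarrow> real) set" where
  "H2_circle = {u. continuous_on UNIV u \<and> L2_circle u \<and>
     (\<forall>k\<in>{1, 2}. \<exists>g. L2_circle g \<and> has_weak_deriv k u g)}"

definition energy :: "(real \<Rightarrow> real) \<Rightarrow> real" where
  "energy u = (LBINT \<theta>:{0..2 * pi}.
     (weak_deriv 2 u \<theta>)\<^sup>2 - 10 * (weak_deriv 1 u \<theta>)\<^sup>2 + 9 * (u \<theta>)\<^sup>2)"

text \<open>The 1-Q-curvature of the metric \<open>v\<^sup>-\<^sup>4\<^sup>/\<^sup>3 g\<^sub>s\<close> at \<open>\<theta>\<close>, as a
  function of \<open>v\<close>. The derivatives are classical, so the value is
  meaningful only if \<open>v\<close> is four times differentiable.\<close>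

definition Q_curvature :: "(real \<Rightarrow> real) \<Rightarrow> real \<Rightarrow> real" where
  "Q_curvature v \<theta> = v \<theta> powr (5/3) *
     (1/9 * (deriv ^^ 4) v \<theta> + 10/9 * (deriv ^^ 2) v \<theta> + v \<theta>)"

definition constant_Q_curvature :: "(real \<Rightarrow> real) \<Rightarrow> bool" where
  "constant_Q_curvature v \<longleftrightarrow>
     (\<forall>k<4. \<forall>\<theta>. ((deriv ^^ k) v) differentiable (at \<theta>)) \<and>
     (\<exists>K. \<forall>\<theta>. Q_curvature v \<theta> = K)"

end

theory Submission
  imports Defs
begin

text \<open>The energy and \<open>\<integral> u\<^sup>-\<^sup>2\<^sup>/\<^sup>3\<close> are invariant under the action of
  \<open>SL(2, \<real>)\<close> on densities of weight \<open>-3/2\<close>, and on the \<open>k\<close>-th Fourier mode the energy is multiplication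
  by \<open>(k\<^sup>2 - 1) (k\<^sup>2 - 9)\<close>, which is negative only for \<open>k = 2\<close>. Choose the group element that minimises
  the mean of the transformed function; the first-order conditions say precisely that its
  second Fourier modes vanish. For this representative the energy is at least \<open>9 / (2 \<pi>)\<close> times the squared
  integral, and Hoelder's inequality against \<open>\<integral> u\<^sup>-\<^sup>2\<^sup>/\<^sup>3\<close> gives the sharp constant. Equality forces the
  representative to be constant.

  The transformation law is only needed for trigonometric polynomials: the Fourier partial sums \<open>S\<^sub>N\<close>
  of \<open>u \<in> H\<^sup>2\<close> converge uniformly, and by Bessel's inequality the limit superior of the energies of
  the \<open>S\<^sub>N\<close> is at most the energy of \<open>u\<close>. The mean of the function transformed by the group
  element with parameters \<open>Q\<close>, \<open>R\<close> is, up to the factor \<open>2 \<pi>\<close>, the integral of \<open>u W\<^sup>-\<^sup>5\<^sup>/\<^sup>2\<close> with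
  \<open>W = P - Q cos 2x - R sin 2x\<close> and \<open>P\<^sup>2 = 1 + Q\<^sup>2 + R\<^sup>2\<close>.\<close>

section \<open>Uniqueness of Fourier coefficients\<close>

text \<open>The mean is the right quantity to minimise because its derivative at the identity, in
  the directions of the symmetric trace-free matrices, is a multiple of the second Fourier
  coefficients: criticality removes exactly the one mode on which the energy is negative. A
  minimiser exists because \<open>u\<close> is bounded below by a positive constant, which makes the
  mean blow up as the group element leaves every compact set. The obstacle is that \<open>u\<close>
  has only weak derivatives, so its pullback would need a chain rule for them. Therefore all that
  survives the passage to the limit is phrased in the original variable: the mean as an integral of
  \<open>u\<close> against a weight, and Hoelder's inequality through
  \<open>1 / W = (u W^(-5/2))^(2/5) (u^(-2/3))^(3/5)\<close>, where \<open>1 / W\<close> is the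
  derivative of a circle diffeomorphism and has integral \<open>2 pi\<close> for all parameters. The
  constant is then \<open>9 / (2 pi) (2 pi)^5 = 144 pi^4\<close>, and the equality case yields
  \<open>u = c W^(3/2)\<close> directly, without transforming \<open>u\<close>.\<close>

abbreviation circ :: "real measure" where
  "circ \<equiv> restrict_space lborel {0..2 * pi}"

lemma finite_measure_circ: "finite_measure circ"
proof (rule finite_measureI)
  show "emeasure circ (space circ) \<noteq> \<infinity>"
    by (simp add: emeasure_restrict_space space_restrict_space)
qed

lemma set_integral_circ: "(LBINT x:{0..2 * pi}. f x) = (\<integral>x. f x \<partial>circ)"
  for f :: "real \<Rightarrow> real"
  by (simp add: set_lebesgue_integral_def integral_restrict_space)

lemma set_integrable_circ: "set_integrable lborel {0..2 * pi} f \<longleftrightarrow> integrable circ f"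
  for f :: "real \<Rightarrow> real"
  by (simp add: set_integrable_def integrable_restrict_space)

lemma integrable_circ_continuous:
  fixes f :: "real \<Rightarrow> real"
  assumes "continuous_on {0..2 * pi} f"
  shows "integrable circ f"
  using borel_integrable_atLeastAtMost'[OF assms] by (simp add: set_integrable_circ)

lemma measurable_circ: "f \<in> borel_measurable borel \<Longrightarrow> f \<in> borel_measurable circ"
  by (auto intro: measurable_restrict_space1)

lemma circ_integral_eq_integral:
  fixes f :: "real \<Rightarrow> real"
  assumes "continuous_on {0..2 * pi} f"
  shows "(\<integral>x. f x \<partial>circ) = integral {0..2 * pi} f"
  using set_borel_integral_eq_integral(2)[OF borel_integrable_atLeastAtMost'[OF assms]]
  by (simp add: set_integral_circ)

lemma circ_integral_FTC:
  fixes F f :: "real \<Rightarrow> real"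
  assumes "\<And>x. (F has_real_derivative f x) (at x)" "continuous_on UNIV f"
  shows "(\<integral>x. f x \<partial>circ) = F (2 * pi) - F 0"
proof -
  have "(f has_integral (F (2 * pi) - F 0)) {0..2 * pi}"
    by (intro fundamental_theorem_of_calculus)
      (auto simp: has_real_derivative_iff_has_vector_derivative[symmetric]
            intro: has_field_derivative_at_within assms)
  then show ?thesis
    using circ_integral_eq_integral[OF continuous_on_subset[OF assms(2)]] by auto
qed

section \<open>Trigonometric polynomials and their density\<close>

inductive trig_poly :: "(real \<Rightarrow> real) \<Rightarrow> bool" where
  trig_cos: "trig_poly (\<lambda>x. cos (of_int k * x))"
| trig_sin: "trig_poly (\<lambda>x. sin (of_int k * x))"
| trig_add: "trig_poly f \<Longrightarrow> trig_poly g \<Longrightarrow> trig_poly (\<lambda>x. f x + g x)"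
| trig_scale: "trig_poly f \<Longrightarrow> trig_poly (\<lambda>x. c * f x)"

lemma trig_poly_const: "trig_poly (\<lambda>x. c)"
  using trig_scale[OF trig_cos[of 0], of c] by simp

lemma trig_poly_diff: "trig_poly f \<Longrightarrow> trig_poly g \<Longrightarrow> trig_poly (\<lambda>x. f x - g x)"
  using trig_add[OF _ trig_scale[of g "-1"], of f] by simp

text \<open>Product-to-sum formulas. They produce the frequency \<open>k - m\<close>, which is why
  frequencies range over the integers.\<close>

lemma trig_poly_mult:
  assumes "trig_poly f" "trig_poly g"
  shows "trig_poly (\<lambda>x. f x * g x)"
  using assms(1)
proof induction
  case (trig_cos k)
  show ?case using assms(2)
  proof induction
    case (trig_cos m)
    have "trig_poly (\<lambda>x. 1/2 * (cos (of_int (k - m) * x) + cos (of_int (k + m) * x)))"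
      by (intro trig_poly.intros)
    then show ?case
      by (rule back_subst[of trig_poly]) (rule ext, subst cos_times_cos, simp add: field_simps)
  next
    case (trig_sin m)
    have "trig_poly (\<lambda>x. 1/2 * (sin (of_int (k + m) * x) - sin (of_int (k - m) * x)))"
      by (intro trig_poly.intros trig_poly_diff)
    then show ?case
      by (rule back_subst[of trig_poly]) (rule ext, subst cos_times_sin, simp add: field_simps)
  next
    case (trig_add f g)
    then show ?case using trig_poly.trig_add[OF trig_add.IH] by (simp add: algebra_simps)
  next
    case (trig_scale f c)
    then show ?case using trig_poly.trig_scale[OF trig_scale.IH] by (simp add: algebra_simps)
  qed
next
  case (trig_sin k)
  show ?case using assms(2)
  proof induction
    case (trig_cos m)
    have "trig_poly (\<lambda>x. 1/2 * (sin (of_int (k + m) * x) + sin (of_int (k - m) * x)))"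
      by (intro trig_poly.intros)
    then show ?case
      by (rule back_subst[of trig_poly]) (rule ext, subst sin_times_cos, simp add: field_simps)
  next
    case (trig_sin m)
    have "trig_poly (\<lambda>x. 1/2 * (cos (of_int (k - m) * x) - cos (of_int (k + m) * x)))"
      by (intro trig_poly.intros trig_poly_diff)
    then show ?case
      by (rule back_subst[of trig_poly]) (rule ext, subst sin_times_sin, simp add: field_simps)
  next
    case (trig_add f g)
    then show ?case using trig_poly.trig_add[OF trig_add.IH] by (simp add: algebra_simps)
  next
    case (trig_scale f c)
    then show ?case using trig_poly.trig_scale[OF trig_scale.IH] by (simp add: algebra_simps)
  qed
next
  case (trig_add f g)
  then show ?case using trig_poly.trig_add[OF trig_add.IH] by (simp add: algebra_simps)
next
  case (trig_scale f c)
  then show ?case using trig_poly.trig_scale[OF trig_scale.IH] by (simp add: algebra_simps)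
qed

lemma trig_poly_continuous: "trig_poly f \<Longrightarrow> continuous_on UNIV f"
  by (induction rule: trig_poly.induct) (auto intro!: continuous_intros)

text \<open>A real linear form along \<open>cis\<close> is a combination of cosine and sine; the
  rest follows because trigonometric polynomials form an algebra.\<close>

lemma trig_poly_polynomial_cis:
  assumes "real_polynomial_function (g :: complex \<Rightarrow> real)"
  shows "trig_poly (\<lambda>x. g (cis x))"
  using assms
proof induction
  case (linear f)
  interpret bounded_linear f by fact
  have "f (cis x) = f 1 * cos x + f \<i> * sin x" for x
  proof -
    have "cis x = cos x *\<^sub>R 1 + sin x *\<^sub>R \<i>" by (simp add: complex_eq_iff)
    then show ?thesis by (simp only: add scaleR) simp
  qed
  moreover have "trig_poly (\<lambda>x. f 1 * cos x + f \<i> * sin x)"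
    using trig_add[OF trig_scale[OF trig_cos[of 1]] trig_scale[OF trig_sin[of 1]]] by simp
  ultimately show ?case by simp
qed (auto intro: trig_poly_const trig_add trig_poly_mult)

text \<open>Stone-Weierstrass on the compact unit circle. Working with functions of
  \<open>cis x\<close> builds periodicity in, so the two end points of the period need no matching
  condition.\<close>

lemma trig_poly_dense:
  fixes F :: "complex \<Rightarrow> real"
  assumes "continuous_on (sphere 0 1) F" "e > 0"
  obtains T where "trig_poly T" "\<And>x. \<bar>F (cis x) - T x\<bar> < e"
proof -
  obtain g where g: "real_polynomial_function g" "\<And>z. z \<in> sphere 0 1 \<Longrightarrow> \<bar>F z - g z\<bar> < e"
    using Stone_Weierstrass_real_polynomial_function[OF compact_sphere assms] by metis
  show ?thesis
    using that[OF trig_poly_polynomial_cis[OF g(1)]] g(2) by simp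
qed

lemma integrable_circ_mult_bounded:
  fixes h f :: "real \<Rightarrow> real"
  assumes h: "integrable circ h" and f: "f \<in> borel_measurable circ"
    and b: "\<And>x. x \<in> {0..2*pi} \<Longrightarrow> \<bar>f x\<bar> \<le> B"
  shows "integrable circ (\<lambda>x. h x * f x)"
proof (rule Bochner_Integration.integrable_bound)
  show "integrable circ (\<lambda>x. B * h x)" using h by simp
  show "(\<lambda>x. h x * f x) \<in> borel_measurable circ" using h f by simp
  have "\<bar>h x\<bar> * \<bar>f x\<bar> \<le> \<bar>h x\<bar> * \<bar>B\<bar>" if "x \<in> {0..2*pi}" for x
    using b[OF that] by (intro mult_left_mono) auto
  then show "AE x in circ. norm (h x * f x) \<le> norm (B * h x)"
    by (intro AE_I2) (auto simp: abs_mult space_restrict_space mult.commute)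
qed

lemma integrable_circ_mult_continuous:
  fixes h f :: "real \<Rightarrow> real"
  assumes h: "integrable circ h" and f: "continuous_on UNIV f"
  shows "integrable circ (\<lambda>x. h x * f x)"
proof -
  have "compact (f ` {0..2*pi})"
    by (intro compact_continuous_image continuous_on_subset[OF f]) auto
  then obtain B where "\<And>x. x \<in> {0..2*pi} \<Longrightarrow> \<bar>f x\<bar> \<le> B"
    by (metis compact_imp_bounded bounded_real imageI)
  then show ?thesis
    by (intro integrable_circ_mult_bounded[OF h]) (auto intro: measurable_circ borel_measurable_continuous_onI f)
qed

lemma trig_poly_orthogonal:
  assumes h: "integrable circ h"
    and c: "\<And>k::nat. (\<integral>x. h x * cos (real k * x) \<partial>circ) = 0"
    and s: "\<And>k::nat. (\<integral>x. h x * sin (real k * x) \<partial>circ) = 0"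
    and T: "trig_poly T"
  shows "(\<integral>x. h x * T x \<partial>circ) = 0"
  using T
proof induction
  case (trig_cos k)
  have "cos (of_int k * x) = cos (real (nat \<bar>k\<bar>) * x)" for x
    by (cases "k \<ge> 0") auto
  then show ?case using c[of "nat \<bar>k\<bar>"] by (simp only:)
next
  case (trig_sin k)
  have "sin (of_int k * x) = of_int (sgn k) * sin (real (nat \<bar>k\<bar>) * x)" for x
    by (cases "k \<ge> 0") (auto simp: sgn_if)
  then have "(\<lambda>x. h x * sin (of_int k * x)) = (\<lambda>x. of_int (sgn k) * (h x * sin (real (nat \<bar>k\<bar>) * x)))"
    by auto
  then show ?case using s[of "nat \<bar>k\<bar>"] by (simp only: integral_mult_right_zero)
next
  case (trig_add f g)
  then show ?case
    by (simp add: distrib_left integrable_circ_mult_continuous[OF h trig_poly_continuous])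
next
  case (trig_scale f c)
  then show ?case by (simp add: mult.left_commute)
qed

text \<open>Continuous functions of \<open>cis x\<close> play the role of continuous periodic functions.\<close>

lemma continuous_orthogonal:
  fixes F :: "complex \<Rightarrow> real"
  assumes h: "integrable circ h"
    and c: "\<And>k::nat. (\<integral>x. h x * cos (real k * x) \<partial>circ) = 0"
    and s: "\<And>k::nat. (\<integral>x. h x * sin (real k * x) \<partial>circ) = 0"
    and F: "continuous_on UNIV F"
  shows "(\<integral>x. h x * F (cis x) \<partial>circ) = 0"
proof -
  have cF: "continuous_on UNIV (\<lambda>x. F (cis x))"
    by (intro continuous_on_compose2[OF F] continuous_intros) auto
  have "\<bar>\<integral>x. h x * F (cis x) \<partial>circ\<bar> \<le> e * (\<integral>x. \<bar>h x\<bar> \<partial>circ)" if "e > 0" for e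
  proof -
    obtain T where T: "trig_poly T" "\<And>x. \<bar>F (cis x) - T x\<bar> < e"
      using trig_poly_dense[OF continuous_on_subset[OF F] \<open>e > 0\<close>] by auto
    note cT = trig_poly_continuous[OF T(1)]
    have i: "integrable circ (\<lambda>x. h x * (F (cis x) - T x))"
      by (intro integrable_circ_mult_continuous h continuous_intros cF cT)
    have "(\<integral>x. h x * F (cis x) \<partial>circ) = (\<integral>x. h x * (F (cis x) - T x) \<partial>circ)"
      using trig_poly_orthogonal[OF h c s T(1)]
      by (simp add: right_diff_distrib integrable_circ_mult_continuous[OF h cF]
          integrable_circ_mult_continuous[OF h cT])
    also have "\<bar>\<dots>\<bar> \<le> (\<integral>x. \<bar>h x * (F (cis x) - T x)\<bar> \<partial>circ)"
      by (rule integral_abs_bound)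
    also have "\<dots> \<le> (\<integral>x. e * \<bar>h x\<bar> \<partial>circ)"
    proof (rule integral_mono)
      fix x
      have "\<bar>F (cis x) - T x\<bar> * \<bar>h x\<bar> \<le> e * \<bar>h x\<bar>"
        using T(2)[of x] by (intro mult_right_mono) auto
      then show "\<bar>h x * (F (cis x) - T x)\<bar> \<le> e * \<bar>h x\<bar>" by (simp add: abs_mult mult.commute)
    qed (use h i in auto)
    also have "\<dots> = e * (\<integral>x. \<bar>h x\<bar> \<partial>circ)" by simp
    finally show ?thesis .
  qed
  note * = this
  have "\<bar>\<integral>x. h x * F (cis x) \<partial>circ\<bar> \<le> 0"
  proof (rule field_le_epsilon)
    fix e :: real assume "e > 0"
    define H where "H = (\<integral>x. \<bar>h x\<bar> \<partial>circ)"
    have H: "H \<ge> 0" by (simp add: H_def)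
    have "e / (H + 1) * H \<le> e"
      using H \<open>e > 0\<close> by (simp add: field_simps)
    moreover have "e / (H + 1) > 0" using H \<open>e > 0\<close> by simp
    ultimately show "\<bar>\<integral>x. h x * F (cis x) \<partial>circ\<bar> \<le> 0 + e"
      using *[of "e / (H + 1)"] unfolding H_def[symmetric] by linarith
  qed
  then show ?thesis by simp
qed

section \<open>The uniqueness theorem\<close>

lemma AE_circ_interior: "AE x in circ. x \<in> {0<..<2*pi}"
proof -
  have "AE x in lborel. x \<noteq> 0" "AE x in lborel. x \<noteq> 2*pi"
    by (auto simp: AE_lborel_singleton)
  then have "AE x in lborel. x \<in> {0..2*pi} \<longrightarrow> x \<in> {0<..<2*pi}"
    by eventually_elim auto
  moreover have "{0..2*pi} \<inter> space lborel \<in> sets lborel" by simp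
  ultimately show ?thesis by (simp only: AE_restrict_space_iff)
qed

text \<open>\<open>cis\<close> identifies the two end points of the period, so one of the two points
  has to be interior.\<close>

lemma cis_eq_imp_eq:
  assumes "cis x = cis y" "x \<in> {0<..<2*pi}" "y \<in> {0..2*pi}"
  shows "x = y"
proof -
  have "cos (x - y) = 1"
    using assms(1) by (simp add: cos_diff complex_eq_iff)
  then obtain n :: int where n: "x - y = of_int n * 2 * pi" 
    using cos_one_2pi_int by auto
  have "\<bar>x - y\<bar> < 2 * pi" using assms by auto
  then have "\<bar>of_int n\<bar> * (2 * pi) < 1 * (2 * pi)" by (simp add: n abs_mult)
  then have "\<bar>real_of_int n\<bar> < 1" by (subst (asm) mult_less_cancel_right_pos) auto
  then have "n = 0" by linarith
  then show ?thesis using n by simp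
qed

text \<open>Orthogonality passes from continuous functions to indicators of closed sets by dominated
  convergence, and from closed sets to Borel sets by the pi-lambda argument; a density whose
  integral over every Borel set is zero vanishes almost everywhere.\<close>

lemma fourier_unique:
  assumes h: "integrable circ h"
    and c: "\<And>k::nat. (\<integral>x. h x * cos (real k * x) \<partial>circ) = 0"
    and s: "\<And>k::nat. (\<integral>x. h x * sin (real k * x) \<partial>circ) = 0"
  shows "AE x in circ. h x = 0"
proof -
  note [measurable] = borel_measurable_integrable[OF h]
  have closed0: "(\<integral>x. h x * indicator C x \<partial>circ) = 0" if C: "closed C" for C :: "real set"
  \<comment> \<open>The empty case is split off because \<open>infdist\<close> to the empty set is
    0, which would make the functions \<open>F\<close> below constantly 1.\<close>
  proof (cases "C \<inter> {0..2*pi} = {}")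
    case True
    then have "(\<integral>x. h x * indicator C x \<partial>circ) = (\<integral>x. 0 \<partial>circ)"
      by (intro Bochner_Integration.integral_cong) (auto simp: space_restrict_space indicator_def)
    then show ?thesis by simp
  next
    case False
    define K where "K = cis ` (C \<inter> {0..2*pi})"
    have K: "compact K" "K \<noteq> {}" unfolding K_def using False
      by (auto intro!: compact_continuous_image continuous_intros closed_Int_compact C)
    \<comment> \<open>Continuous functions on the plane decreasing to the indicator of the closed
      set \<open>K\<close>.\<close>
    define F where "F n z = max 0 (1 - real n * infdist z K)" for n z
    have F01: "0 \<le> F n z" "F n z \<le> 1" for n z
      unfolding F_def by (auto simp: infdist_nonneg)
    have cF: "continuous_on UNIV (F n)" for n
      unfolding F_def by (intro continuous_intros)
    have cF': "continuous_on UNIV (\<lambda>x. F n (cis x))" for n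
      by (intro continuous_on_compose2[OF cF] continuous_intros) auto
    \<comment> \<open>This can fail at an end point, where the limit is 1 as soon as either end
      point lies in \<open>C\<close>.\<close>
    have lim: "(\<lambda>n. F n (cis x)) \<longlonglongrightarrow> indicator C x" if x: "x \<in> {0<..<2*pi}" for x
    proof (cases "x \<in> C")
      case True
      then have "cis x \<in> K" using x by (auto simp: K_def)
      then show ?thesis using True by (simp add: F_def)
    next
      case False
      then have "cis x \<notin> K" using cis_eq_imp_eq[OF _ x] by (auto simp: K_def)
      then have "infdist (cis x) K > 0"
        using infdist_pos_not_in_closed[OF compact_imp_closed[OF K(1)] K(2)] by simp
      then obtain N where N: "real N * infdist (cis x) K > 1"
        using ex_less_of_nat_mult by blast
      have "F n (cis x) = 0" if "n \<ge> N" for n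
      proof -
        have "real N * infdist (cis x) K \<le> real n * infdist (cis x) K"
          using that by (intro mult_right_mono) (auto simp: infdist_nonneg)
        then show ?thesis using N by (simp add: F_def)
      qed
      then have "eventually (\<lambda>n. F n (cis x) = 0) sequentially"
        using eventually_sequentially by blast
      then show ?thesis using False by (simp add: tendsto_eventually)
    qed
    have "(\<lambda>n. \<integral>x. h x * F n (cis x) \<partial>circ) \<longlonglongrightarrow> (\<integral>x. h x * indicator C x \<partial>circ)"
    proof (rule integral_dominated_convergence[where w = "\<lambda>x. \<bar>h x\<bar>"])
      show "(\<lambda>x. h x * indicat_real C x) \<in> borel_measurable circ"
        using C by (intro borel_measurable_times[OF borel_measurable_integrable[OF h] measurable_circ]
            borel_measurable_indicator) auto
      show "(\<lambda>x. h x * F n (cis x)) \<in> borel_measurable circ" for n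
        using borel_measurable_integrable[OF integrable_circ_mult_continuous[OF h cF']] .
      show "integrable circ (\<lambda>x. \<bar>h x\<bar>)" using h by simp
      show "AE x in circ. (\<lambda>n. h x * F n (cis x)) \<longlonglongrightarrow> h x * indicator C x"
        using AE_circ_interior by eventually_elim (intro tendsto_intros lim)
      show "AE x in circ. norm (h x * F n (cis x)) \<le> \<bar>h x\<bar>" for n
        using F01[of n] by (intro AE_I2) (auto simp: abs_mult intro!: mult_left_le)
    qed
    moreover have "(\<integral>x. h x * F n (cis x) \<partial>circ) = 0" for n
      by (rule continuous_orthogonal[OF h c s cF])
    ultimately show ?thesis by (simp add: LIMSEQ_const_iff)
  qed
  have ind: "integrable circ (\<lambda>x. h x * indicator A x)" if "A \<in> sets borel" for A
    using that by (intro integrable_circ_mult_bounded[OF h, of _ 1] measurable_circ borel_measurable_indicator)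
       (auto simp: indicator_def)
  have borel0: "(\<integral>x. h x * indicator A x \<partial>circ) = 0" if "A \<in> sets borel" for A
  proof -
    have A: "A \<in> sigma_sets UNIV (Collect closed)"
      using that unfolding borel_eq_closed by simp
    have st: "Int_stable (Collect closed :: real set set)" by (auto simp: Int_stable_def)
    show ?thesis
    proof (induction rule: sigma_sets_induct_disjoint[OF st subset_UNIV[of "Collect closed", folded Pow_UNIV] A,
          case_names basic empty compl union])
      case (compl A)
      then have A: "A \<in> sets borel" unfolding borel_eq_closed by simp
      have "(\<integral>x. h x * indicator (UNIV - A) x \<partial>circ) = (\<integral>x. h x - h x * indicator A x \<partial>circ)"
        by (intro Bochner_Integration.integral_cong) (auto simp: indicator_def)
      also have "\<dots> = (\<integral>x. h x \<partial>circ)" using h ind[OF A] compl by simp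
      also have "\<dots> = 0" using c[of 0] by simp
      finally show ?case .
    next
      case (union A)
      then have A: "A i \<in> sets borel" for i unfolding borel_eq_closed by auto
      have sum_eq: "(\<Sum>i<n. h x * indicator (A i) x) = h x * indicator (\<Union>i<n. A i) x" for n x
      proof -
        have "(\<Sum>i<n. indicat_real (A i) x) = indicator (\<Union>i<n. A i) x"
          using union(1) by (intro indicator_UN_disjoint[symmetric])
             (auto simp: disjoint_family_on_def)
        then show ?thesis by (simp add: sum_distrib_left[symmetric])
      qed
      have lim: "(\<lambda>n. \<Sum>i<n. h x * indicator (A i) x) \<longlonglongrightarrow> h x * indicator (\<Union>i. A i) x" for x
        unfolding sum_eq by (intro tendsto_intros LIMSEQ_indicator_UN)
      have bd: "\<bar>\<Sum>i<n. h x * indicator (A i) x\<bar> \<le> \<bar>h x\<bar>" for n x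
        unfolding sum_eq by (simp add: abs_mult indicator_def)
      have "(\<lambda>n. \<integral>x. (\<Sum>i<n. h x * indicator (A i) x) \<partial>circ) \<longlonglongrightarrow> (\<integral>x. h x * indicator (\<Union>i. A i) x \<partial>circ)"
      proof (rule integral_dominated_convergence[where w = "\<lambda>x. \<bar>h x\<bar>"])
        show "(\<lambda>x. h x * indicator (\<Union>i. A i) x) \<in> borel_measurable circ"
          using A by (intro borel_measurable_integrable ind) auto
        show "(\<lambda>x. \<Sum>i<n. h x * indicator (A i) x) \<in> borel_measurable circ" for n
          using A by (intro borel_measurable_sum borel_measurable_integrable ind) auto
      qed (use h lim bd in auto)
      moreover have "(\<integral>x. (\<Sum>i<n. h x * indicator (A i) x) \<partial>circ) = 0" for n
        by (subst Bochner_Integration.integral_sum) (use union(3) ind[OF A] in auto)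
      ultimately show ?case by (simp add: LIMSEQ_const_iff)
    qed (auto simp: closed0 Int_stable_def)
  qed
  show ?thesis
  proof (rule density_unique_real[OF h, of "\<lambda>_. 0"])
    fix A assume "A \<in> sets circ"
    then have "A \<in> sets borel" by (auto simp: sets_restrict_space)
    from borel0[OF this] show "set_lebesgue_integral circ A h = (LINT x:A|circ. 0)"
      by (simp add: set_lebesgue_integral_def mult.commute)
  qed simp
qed

section \<open>Fourier partial sums and the energy\<close>

lemma integrable_circ_square_imp:
  fixes f :: "real \<Rightarrow> real"
  assumes "f \<in> borel_measurable circ" "integrable circ (\<lambda>x. (f x)\<^sup>2)"
  shows "integrable circ f"
proof (rule Bochner_Integration.integrable_bound)
  interpret finite_measure circ by (rule finite_measure_circ)
  show "integrable circ (\<lambda>x. 1 + (f x)\<^sup>2)" using assms by simp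
  have "\<bar>y\<bar> \<le> 1 + y\<^sup>2" for y :: real
    using sum_squares_bound[of "\<bar>y\<bar>" 1] by (auto simp: abs_if power2_eq_square split: if_splits)
  then have "norm (f x) \<le> norm (1 + (f x)\<^sup>2)" for x
    using abs_ge_self[of "1 + (f x)\<^sup>2"] order_trans unfolding real_norm_def by blast
  then show "AE x in circ. norm (f x) \<le> norm (1 + (f x)\<^sup>2)" by simp
qed (use assms in auto)

lemma integrable_circ_continuous_UNIV: "continuous_on UNIV f \<Longrightarrow> integrable circ f"
  for f :: "real \<Rightarrow> real"
  by (auto intro: integrable_circ_continuous continuous_on_subset)

section \<open>Fourier coefficients, orthogonality, Parseval and Bessel\<close>

definition fourier_wt :: "nat \<Rightarrow> real" where
  "fourier_wt k = (if k = 0 then 2 * pi else pi)"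

text \<open>Dividing by the squared norm of \<open>cos (k x)\<close> makes the coefficient at 0 the
  mean itself, so Fourier sums carry no factor one half in the constant term.\<close>

definition fourier_cos :: "(real \<Rightarrow> real) \<Rightarrow> nat \<Rightarrow> real" where
  "fourier_cos f k = (\<integral>x. f x * cos (real k * x) \<partial>circ) / fourier_wt k"

definition fourier_sin :: "(real \<Rightarrow> real) \<Rightarrow> nat \<Rightarrow> real" where
  "fourier_sin f k = (\<integral>x. f x * sin (real k * x) \<partial>circ) / fourier_wt k"

definition trig_sum :: "(nat \<Rightarrow> real) \<Rightarrow> (nat \<Rightarrow> real) \<Rightarrow> nat \<Rightarrow> real \<Rightarrow> real" where
  "trig_sum a b N x = (\<Sum>k<N. a k * cos (real k * x) + b k * sin (real k * x))"

lemma fourier_wt_pos: "fourier_wt k > 0"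
  by (simp add: fourier_wt_def)

lemma fourier_wt_nonzero [simp]: "fourier_wt k \<noteq> 0"
  by (simp add: fourier_wt_def)

lemma fourier_sin_0 [simp]: "fourier_sin f 0 = 0"
  by (simp add: fourier_sin_def)

lemma continuous_trig_sum: "continuous_on S (trig_sum a b N)"
  unfolding trig_sum_def by (intro continuous_intros)

lemma trig_sum_deriv:
  "(trig_sum a b N has_real_derivative
     trig_sum (\<lambda>k. real k * b k) (\<lambda>k. - real k * a k) N x) (at x)"
  unfolding trig_sum_def
  by (auto intro!: derivative_eq_intros DERIV_sum simp: algebra_simps)

lemma trig_sum_periodic: "trig_sum a b N (x + 2 * pi) = trig_sum a b N x"
proof -
  have "real k * (x + 2 * pi) = real k * x + 2 * pi * real_of_int (int k)" for k
    by (simp add: algebra_simps)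
  then show ?thesis unfolding trig_sum_def
    by (simp only: cos_add sin_add cos_int_2pin sin_int_2pin) simp
qed

lemma circ_integral_cos_int: "(\<integral>x. cos (of_int j * x) \<partial>circ) = (if j = 0 then 2 * pi else 0)"
proof (cases "j = 0")
  case True
  have "(\<integral>x. 1 \<partial>circ) = 2 * pi - 0"
    by (rule circ_integral_FTC) (auto intro!: derivative_eq_intros)
  then show ?thesis using True by simp
next
  case False
  have "(\<integral>x. cos (of_int j * x) \<partial>circ) = sin (of_int j * (2 * pi)) / of_int j - sin (of_int j * 0) / of_int j"
    using False by (intro circ_integral_FTC) (auto intro!: derivative_eq_intros continuous_intros)
  then show ?thesis using False sin_int_2pin[of j] by (simp add: mult.commute)
qed

lemma circ_integral_sin_int: "(\<integral>x. sin (of_int j * x) \<partial>circ) = 0"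
proof (cases "j = 0")
  case False
  have "(\<integral>x. sin (of_int j * x) \<partial>circ) = (- cos (of_int j * (2 * pi)) / of_int j) - (- cos (of_int j * 0) / of_int j)"
    using False by (intro circ_integral_FTC) (auto intro!: derivative_eq_intros continuous_intros)
  then show ?thesis using False cos_int_2pin[of j] by (simp add: mult.commute)
qed simp

lemma circ_integrable_trig [simp, intro]:
  "integrable circ (\<lambda>x. cos (c * x))" "integrable circ (\<lambda>x. sin (c * x))"
  by (auto intro!: integrable_circ_continuous continuous_intros)

lemma circ_cos_cos:
  "(\<integral>x. cos (real k * x) * cos (real m * x) \<partial>circ) = (if k = m then fourier_wt k else 0)"
proof -
  have "(\<integral>x. cos (real k * x) * cos (real m * x) \<partial>circ) =
     (\<integral>x. 1/2 * (cos (of_int (int k - int m) * x) + cos (of_int (int k + int m) * x)) \<partial>circ)"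
    by (intro Bochner_Integration.integral_cong refl) (subst cos_times_cos, simp add: left_diff_distrib distrib_right)
  also have "\<dots> = 1/2 * ((\<integral>x. cos (of_int (int k - int m) * x) \<partial>circ) + (\<integral>x. cos (of_int (int k + int m) * x) \<partial>circ))"
    by (simp only: integral_mult_right_zero Bochner_Integration.integral_add circ_integrable_trig)
  finally show ?thesis by (simp only: circ_integral_cos_int) (auto simp: fourier_wt_def)
qed

lemma circ_sin_sin:
  "(\<integral>x. sin (real k * x) * sin (real m * x) \<partial>circ) = (if k = m \<and> k \<noteq> 0 then fourier_wt k else 0)"
proof -
  have "(\<integral>x. sin (real k * x) * sin (real m * x) \<partial>circ) =
     (\<integral>x. 1/2 * (cos (of_int (int k - int m) * x) - cos (of_int (int k + int m) * x)) \<partial>circ)"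
    by (intro Bochner_Integration.integral_cong refl) (subst sin_times_sin, simp add: left_diff_distrib distrib_right)
  also have "\<dots> = 1/2 * ((\<integral>x. cos (of_int (int k - int m) * x) \<partial>circ) - (\<integral>x. cos (of_int (int k + int m) * x) \<partial>circ))"
    by (simp only: integral_mult_right_zero Bochner_Integration.integral_diff circ_integrable_trig)
  finally show ?thesis by (simp only: circ_integral_cos_int) (auto simp: fourier_wt_def)
qed

lemma circ_sin_cos: "(\<integral>x. sin (real k * x) * cos (real m * x) \<partial>circ) = 0"
proof -
  have "(\<integral>x. sin (real k * x) * cos (real m * x) \<partial>circ) =
     (\<integral>x. 1/2 * (sin (of_int (int k + int m) * x) + sin (of_int (int k - int m) * x)) \<partial>circ)"
    by (intro Bochner_Integration.integral_cong refl) (subst sin_times_cos, simp add: left_diff_distrib distrib_right)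
  also have "\<dots> = 1/2 * ((\<integral>x. sin (of_int (int k + int m) * x) \<partial>circ) + (\<integral>x. sin (of_int (int k - int m) * x) \<partial>circ))"
    by (simp only: integral_mult_right_zero Bochner_Integration.integral_add circ_integrable_trig)
  finally show ?thesis by (simp only: circ_integral_sin_int) simp
qed

lemma circ_cos_sin: "(\<integral>x. cos (real k * x) * sin (real m * x) \<partial>circ) = 0"
  using circ_sin_cos[of m k] by (simp add: mult.commute)

lemma integral_mult_trig_sum:
  assumes h: "integrable circ h"
  shows "(\<integral>x. h x * trig_sum a b N x \<partial>circ) =
    (\<Sum>k<N. fourier_wt k * (a k * fourier_cos h k + b k * fourier_sin h k))"
proof -
  have i: "integrable circ (\<lambda>x. h x * cos (real k * x))" "integrable circ (\<lambda>x. h x * sin (real k * x))" for k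
    by (intro integrable_circ_mult_continuous h continuous_intros)+
  have "(\<integral>x. h x * trig_sum a b N x \<partial>circ) =
     (\<integral>x. (\<Sum>k<N. a k * (h x * cos (real k * x)) + b k * (h x * sin (real k * x))) \<partial>circ)"
    by (simp add: trig_sum_def sum_distrib_left algebra_simps)
  also have "\<dots> = (\<Sum>k<N. a k * (\<integral>x. h x * cos (real k * x) \<partial>circ) + b k * (\<integral>x. h x * sin (real k * x) \<partial>circ))"
    by (simp add: i)
  also have "\<dots> = (\<Sum>k<N. fourier_wt k * (a k * fourier_cos h k + b k * fourier_sin h k))"
    by (intro sum.cong) (auto simp: fourier_cos_def fourier_sin_def field_simps)
  finally show ?thesis .
qed

lemma fourier_trig_sum:
  assumes "m < N"
  shows "fourier_cos (trig_sum a b N) m = a m" "m \<noteq> 0 \<Longrightarrow> fourier_sin (trig_sum a b N) m = b m"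
proof -
  have "(\<integral>x. cos (real m * x) * trig_sum a b N x \<partial>circ) = (\<Sum>k<N. if k = m then fourier_wt m * a m else 0)"
    unfolding integral_mult_trig_sum[OF circ_integrable_trig(1)] fourier_cos_def fourier_sin_def
    by (intro sum.cong) (auto simp: circ_cos_cos circ_cos_sin)
  then show "fourier_cos (trig_sum a b N) m = a m"
    using assms fourier_wt_pos[of m] by (simp add: fourier_cos_def mult.commute)
  assume "m \<noteq> 0"
  then have "(\<integral>x. sin (real m * x) * trig_sum a b N x \<partial>circ) = (\<Sum>k<N. if k = m then fourier_wt m * b m else 0)"
    unfolding integral_mult_trig_sum[OF circ_integrable_trig(2)] fourier_cos_def fourier_sin_def
    by (intro sum.cong) (auto simp: circ_sin_sin circ_sin_cos)
  then show "fourier_sin (trig_sum a b N) m = b m"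
    using assms fourier_wt_pos[of m] by (simp add: fourier_sin_def mult.commute)
qed

text \<open>The coefficient \<open>b 0\<close> multiplies \<open>sin 0\<close> and is invisible in
  the function, but it would be counted on the right-hand side; hence the assumption.\<close>

lemma trig_sum_Parseval:
  assumes "b 0 = 0"
  shows "(\<integral>x. (trig_sum a b N x)\<^sup>2 \<partial>circ) = (\<Sum>k<N. fourier_wt k * ((a k)\<^sup>2 + (b k)\<^sup>2))"
proof -
  have "(\<integral>x. (trig_sum a b N x)\<^sup>2 \<partial>circ) = (\<integral>x. trig_sum a b N x * trig_sum a b N x \<partial>circ)"
    by (simp add: power2_eq_square)
  also have "\<dots> = (\<Sum>k<N. fourier_wt k * (a k * fourier_cos (trig_sum a b N) k + b k * fourier_sin (trig_sum a b N) k))"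
    by (intro integral_mult_trig_sum integrable_circ_continuous continuous_trig_sum)
  also have "\<dots> = (\<Sum>k<N. fourier_wt k * ((a k)\<^sup>2 + (b k)\<^sup>2))"
  proof (intro sum.cong refl)
    fix k assume "k \<in> {..<N}"
    then show "fourier_wt k * (a k * fourier_cos (trig_sum a b N) k + b k * fourier_sin (trig_sum a b N) k)
       = fourier_wt k * ((a k)\<^sup>2 + (b k)\<^sup>2)"
      using assms by (cases "k = 0") (auto simp: fourier_trig_sum power2_eq_square)
  qed
  finally show ?thesis .
qed

lemma Bessel:
  assumes f: "f \<in> borel_measurable circ" "integrable circ (\<lambda>x. (f x)\<^sup>2)"
  shows "(\<Sum>k<N. fourier_wt k * ((fourier_cos f k)\<^sup>2 + (fourier_sin f k)\<^sup>2)) \<le> (\<integral>x. (f x)\<^sup>2 \<partial>circ)"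
proof -
  let ?T = "trig_sum (fourier_cos f) (fourier_sin f) N"
  let ?S = "\<Sum>k<N. fourier_wt k * ((fourier_cos f k)\<^sup>2 + (fourier_sin f k)\<^sup>2)"
  have i: "integrable circ f" by (rule integrable_circ_square_imp[OF f])
  have T2: "(\<integral>x. (?T x)\<^sup>2 \<partial>circ) = ?S" by (rule trig_sum_Parseval) simp
  have fT: "(\<integral>x. f x * ?T x \<partial>circ) = ?S"
    unfolding integral_mult_trig_sum[OF i] by (simp add: power2_eq_square)
  have i1: "integrable circ (\<lambda>x. f x * ?T x)" 
    by (intro integrable_circ_mult_continuous i continuous_trig_sum)
  have i2: "integrable circ (\<lambda>x. (?T x)\<^sup>2)"
    by (intro integrable_circ_continuous continuous_intros continuous_trig_sum)
  have "0 \<le> (\<integral>x. (f x - ?T x)\<^sup>2 \<partial>circ)" by simp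
  also have "\<dots> = (\<integral>x. (f x)\<^sup>2 - 2 * (f x * ?T x) + (?T x)\<^sup>2 \<partial>circ)"
    by (simp add: power2_diff algebra_simps)
  also have "\<dots> = (\<integral>x. (f x)\<^sup>2 \<partial>circ) - 2 * ?S + ?S"
    using i1 i2 f(2) by (simp add: fT T2)
  finally show ?thesis by simp
qed

text \<open>\<open>f\<^sub>1\<close> and \<open>f\<^sub>2\<close> are the first and second weak derivatives of \<open>f\<close>, tested against the
  trigonometric functions only.\<close>

definition circle_H2 :: "(real \<Rightarrow> real) \<Rightarrow> (real \<Rightarrow> real) \<Rightarrow> (real \<Rightarrow> real) \<Rightarrow> bool" where
  "circle_H2 f f1 f2 \<longleftrightarrow> continuous_on UNIV f \<and>
     f1 \<in> borel_measurable circ \<and> integrable circ (\<lambda>x. (f1 x)\<^sup>2) \<and>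
     f2 \<in> borel_measurable circ \<and> integrable circ (\<lambda>x. (f2 x)\<^sup>2) \<and>
     (\<forall>k. fourier_cos f1 k = real k * fourier_sin f k \<and> fourier_sin f1 k = - real k * fourier_cos f k \<and>
          fourier_cos f2 k = - (real k)\<^sup>2 * fourier_cos f k \<and> fourier_sin f2 k = - (real k)\<^sup>2 * fourier_sin f k)"

definition energy3 :: "(real \<Rightarrow> real) \<Rightarrow> (real \<Rightarrow> real) \<Rightarrow> (real \<Rightarrow> real) \<Rightarrow> real" where
  "energy3 f f1 f2 = (\<integral>x. (f2 x)\<^sup>2 \<partial>circ) - 10 * (\<integral>x. (f1 x)\<^sup>2 \<partial>circ) + 9 * (\<integral>x. (f x)\<^sup>2 \<partial>circ)"

definition fourier_sum :: "(real \<Rightarrow> real) \<Rightarrow> nat \<Rightarrow> real \<Rightarrow> real" where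
  "fourier_sum f = trig_sum (fourier_cos f) (fourier_sin f)"

text \<open>Absolute summability allows term-by-term integration, so the limit has the prescribed
  coefficients. The uniqueness theorem can then identify this limit with a function that is known
  only through its coefficients.\<close>

lemma trig_sum_uniform_limit:
  assumes M: "\<And>k. \<bar>a k\<bar> + \<bar>b k\<bar> \<le> M k" and "summable M"
  obtains g where "uniform_limit UNIV (trig_sum a b) g sequentially" "continuous_on UNIV g"
    "(\<lambda>N. \<integral>x. (trig_sum a b N x)\<^sup>2 \<partial>circ) \<longlonglongrightarrow> (\<integral>x. (g x)\<^sup>2 \<partial>circ)"
    "\<And>m. fourier_cos g m = a m" "\<And>m. b 0 = 0 \<Longrightarrow> fourier_sin g m = b m"
proof -
  define g where "g x = (\<Sum>k. a k * cos (real k * x) + b k * sin (real k * x))" for x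
  have bd: "\<bar>a k * cos (real k * x) + b k * sin (real k * x)\<bar> \<le> M k" for k x
  proof -
    have "\<bar>a k * cos (real k * x) + b k * sin (real k * x)\<bar> \<le> \<bar>a k\<bar> * \<bar>cos (real k * x)\<bar> + \<bar>b k\<bar> * \<bar>sin (real k * x)\<bar>"
      using abs_triangle_ineq by (simp add: abs_mult[symmetric])
    also have "\<dots> \<le> \<bar>a k\<bar> * 1 + \<bar>b k\<bar> * 1"
      by (intro add_mono mult_left_mono) auto
    finally show ?thesis using M[of k] by simp
  qed
  have ul: "uniform_limit UNIV (trig_sum a b) g sequentially"
    unfolding trig_sum_def g_def
    using Weierstrass_m_test[of UNIV "\<lambda>k x. a k * cos (real k * x) + b k * sin (real k * x)" M] bd assms(2)
    by simp
  have cg: "continuous_on UNIV g"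
    by (rule uniform_limit_theorem[OF _ ul]) (auto simp: continuous_trig_sum)
  have M0: "M k \<ge> 0" for k using M[of k] by linarith
  have Tb: "\<bar>trig_sum a b N x\<bar> \<le> suminf M" for N x
  proof -
    have "\<bar>trig_sum a b N x\<bar> \<le> (\<Sum>k<N. M k)"
      unfolding trig_sum_def by (intro order_trans[OF sum_abs] sum_mono bd)
    also have "\<dots> \<le> suminf M" by (intro sum_le_suminf assms) (auto simp: M0)
    finally show ?thesis .
  qed
  have pl: "(\<lambda>N. trig_sum a b N x) \<longlonglongrightarrow> g x" for x
    using tendsto_uniform_limitI[OF ul] by simp
  interpret finite_measure circ by (rule finite_measure_circ)
  have sq: "(\<lambda>N. \<integral>x. (trig_sum a b N x)\<^sup>2 \<partial>circ) \<longlonglongrightarrow> (\<integral>x. (g x)\<^sup>2 \<partial>circ)"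
  proof (rule integral_dominated_convergence[where w = "\<lambda>x. (suminf M)\<^sup>2"])
    show "(\<lambda>x. (g x)\<^sup>2) \<in> borel_measurable circ"
      by (intro borel_measurable_integrable integrable_circ_continuous_UNIV continuous_intros cg)
    show "(\<lambda>x. (trig_sum a b N x)\<^sup>2) \<in> borel_measurable circ" for N
      by (intro borel_measurable_integrable integrable_circ_continuous_UNIV continuous_intros continuous_trig_sum)
    show "AE x in circ. norm ((trig_sum a b N x)\<^sup>2) \<le> (suminf M)\<^sup>2" for N
      using power_mono[OF Tb abs_ge_zero, of _ _ 2] by (intro AE_I2) simp
  qed (auto intro!: tendsto_intros pl)
  have lin: "(\<lambda>N. \<integral>x. trig_sum a b N x * h x \<partial>circ) \<longlonglongrightarrow> (\<integral>x. g x * h x \<partial>circ)"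
    if h: "continuous_on UNIV h" for h
  proof (rule integral_dominated_convergence[where w = "\<lambda>x. suminf M * \<bar>h x\<bar>"])
    show "(\<lambda>x. g x * h x) \<in> borel_measurable circ"
      by (intro borel_measurable_integrable integrable_circ_continuous_UNIV continuous_intros cg h)
    show "(\<lambda>x. trig_sum a b N x * h x) \<in> borel_measurable circ" for N
      by (intro borel_measurable_integrable integrable_circ_continuous_UNIV continuous_intros continuous_trig_sum h)
    show "AE x in circ. norm (trig_sum a b N x * h x) \<le> suminf M * \<bar>h x\<bar>" for N
      using mult_right_mono[OF Tb, of "\<bar>h x\<bar>" for x] by (auto simp: abs_mult)
    show "integrable circ (\<lambda>x. suminf M * \<bar>h x\<bar>)"
      by (intro integrable_circ_continuous_UNIV continuous_intros h)
  qed (auto intro!: tendsto_intros pl)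
  have "fourier_cos g m = a m" for m
  proof -
    have A: "(\<lambda>N. fourier_cos (trig_sum a b N) m) \<longlonglongrightarrow> fourier_cos g m"
      unfolding fourier_cos_def using fourier_wt_pos[of m]
      by (intro tendsto_intros lin continuous_intros) auto
    have B: "eventually (\<lambda>N. fourier_cos (trig_sum a b N) m = a m) sequentially"
      using eventually_gt_at_top[of m] by eventually_elim (rule fourier_trig_sum)
    show ?thesis
      by (rule LIMSEQ_unique[OF A tendsto_eventually[OF B]])
  qed
  moreover have "fourier_sin g m = b m" if "b 0 = 0" for m
  proof (cases "m = 0")
    case False
    have A: "(\<lambda>N. fourier_sin (trig_sum a b N) m) \<longlonglongrightarrow> fourier_sin g m"
      unfolding fourier_sin_def using fourier_wt_pos[of m]
      by (intro tendsto_intros lin continuous_intros) auto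
    have B: "eventually (\<lambda>N. fourier_sin (trig_sum a b N) m = b m) sequentially"
      using eventually_gt_at_top[of m] by eventually_elim (rule fourier_trig_sum, use False in auto)
    show ?thesis
      by (rule LIMSEQ_unique[OF A tendsto_eventually[OF B]])
  qed (use that in simp)
  ultimately show ?thesis using that[OF ul cg sq] by blast
qed

section \<open>From coefficients back to functions: convergence of the Fourier sums\<close>

lemma fourier_coeff_unique:
  assumes f: "integrable circ f" and g: "integrable circ g"
    and "\<And>k. fourier_cos f k = fourier_cos g k" "\<And>k. fourier_sin f k = fourier_sin g k"
  shows "AE x in circ. f x = g x"
proof -
  have i: "integrable circ (\<lambda>x. h x * cos (real k * x))" "integrable circ (\<lambda>x. h x * sin (real k * x))"
    if "integrable circ h" for k h
    by (intro integrable_circ_mult_continuous that continuous_intros)+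
  have "AE x in circ. f x - g x = 0"
  proof (rule fourier_unique)
    show "(\<integral>x. (f x - g x) * cos (real k * x) \<partial>circ) = 0" for k
      using assms(3)[of k] fourier_wt_pos[of k] i[OF f] i[OF g]
      by (simp add: fourier_cos_def left_diff_distrib)
    show "(\<integral>x. (f x - g x) * sin (real k * x) \<partial>circ) = 0" for k
      using assms(4)[of k] fourier_wt_pos[of k] i[OF f] i[OF g]
      by (simp add: fourier_sin_def left_diff_distrib)
  qed (use f g in auto)
  then show ?thesis by eventually_elim simp
qed

lemma AE_circ_continuous_eq:
  fixes f g :: "real \<Rightarrow> real"
  assumes f: "continuous_on UNIV f" and g: "continuous_on UNIV g"
    and "AE x in circ. f x = g x" and x: "x \<in> {0..2*pi}"
  shows "f x = g x"
proof -
  define C where "C = {x. f x = g x}"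
  have C: "closed C" unfolding C_def by (intro closed_Collect_eq f g)
  have "{0..2*pi} \<inter> space lborel \<in> sets lborel" by simp
  then have "AE x in lborel. x \<in> {0..2*pi} \<longrightarrow> f x = g x"
    using assms(3) by (simp only: AE_restrict_space_iff)
  then have "AE x in lborel. x \<in> {0<..<2*pi} \<longrightarrow> x \<in> C"
    by eventually_elim (auto simp: C_def)
  then have "AE x\<in>{0<..<2*pi} in lebesgue. x \<in> C"
    by (rule AE_completion)
  then have "{0<..<2*pi} \<subseteq> C"
    using mem_closed_if_AE_lebesgue_open[OF open_greaterThanLessThan C] by blast
  then have "closure {0<..<2*pi} \<subseteq> C" using C by (rule closure_minimal)
  then show ?thesis using x by (auto simp: closure_greaterThanLessThan C_def)
qed

text \<open>The second-order term enters the energy with a plus sign, so Bessel's inequality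
  suffices for it. The first-order term enters with a minus sign and needs actual convergence; this
  comes from absolute summability of \<open>k a_k\<close> and \<open>k b_k\<close>, and uniqueness
  identifies the limits with \<open>f1\<close> and \<open>f\<close>.\<close>

lemma H2_fourier_limits:
  assumes f: "circle_H2 f f1 f2"
  defines "a \<equiv> fourier_cos f" and "b \<equiv> fourier_sin f"
  defines "S1 \<equiv> trig_sum (\<lambda>k. real k * b k) (\<lambda>k. - real k * a k)"
      and "S2 \<equiv> trig_sum (\<lambda>k. - (real k)\<^sup>2 * a k) (\<lambda>k. - (real k)\<^sup>2 * b k)"
  shows "uniform_limit {0..2*pi} (fourier_sum f) f sequentially"
    and "(\<lambda>N. \<integral>x. (fourier_sum f N x)\<^sup>2 \<partial>circ) \<longlonglongrightarrow> (\<integral>x. (f x)\<^sup>2 \<partial>circ)"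
    and "(\<lambda>N. \<integral>x. (S1 N x)\<^sup>2 \<partial>circ) \<longlonglongrightarrow> (\<integral>x. (f1 x)\<^sup>2 \<partial>circ)"
    and "(\<integral>x. (S2 N x)\<^sup>2 \<partial>circ) \<le> (\<integral>x. (f2 x)\<^sup>2 \<partial>circ)"
proof -
  have cf: "continuous_on UNIV f"
    and f1: "f1 \<in> borel_measurable circ" "integrable circ (\<lambda>x. (f1 x)\<^sup>2)"
    and f2: "f2 \<in> borel_measurable circ" "integrable circ (\<lambda>x. (f2 x)\<^sup>2)"
    and c: "fourier_cos f1 k = real k * b k" "fourier_sin f1 k = - real k * a k"
      "fourier_cos f2 k = - (real k)\<^sup>2 * a k" "fourier_sin f2 k = - (real k)\<^sup>2 * b k" for k
    using f unfolding circle_H2_def a_def b_def by auto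
  have b0: "b 0 = 0" by (simp add: b_def)
  define X where "X k = fourier_wt k * ((- (real k)\<^sup>2 * a k)\<^sup>2 + (- (real k)\<^sup>2 * b k)\<^sup>2)" for k
  have bes: "(\<Sum>k<N. X k) \<le> (\<integral>x. (f2 x)\<^sup>2 \<partial>circ)" for N
    using Bessel[OF f2, of N] by (simp add: c X_def)
  have "(\<integral>x. (S2 N x)\<^sup>2 \<partial>circ) = (\<Sum>k<N. X k)"
    unfolding S2_def X_def by (rule trig_sum_Parseval) (simp add: b0)
  then show "(\<integral>x. (S2 N x)\<^sup>2 \<partial>circ) \<le> (\<integral>x. (f2 x)\<^sup>2 \<partial>circ)" using bes by simp
  have X0: "X k \<ge> 0" for k unfolding X_def using fourier_wt_pos[of k] by simp
  have sX: "summable X"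
    using bes X0 by (intro summableI_nonneg_bounded)
  define M where "M k = X k + 1 / (real k)\<^sup>2" for k
  have sM: "summable M"
    unfolding M_def using sX inverse_power_summable[of 2, where 'a = real]
    by (intro summable_add) (auto simp: inverse_eq_divide)
  have kM: "real k * \<bar>a k\<bar> + real k * \<bar>b k\<bar> \<le> M k" for k
  proof (cases "k = 0")
    case True
    then show ?thesis by (simp add: M_def X_def)
  next
    case False
    have aux: "x + y \<le> 1 / 2 * (A + B) + c" if "2 * x \<le> A + c" "2 * y \<le> B + c" for x y A B c :: real
      using that by (simp add: field_simps)
    \<comment> \<open>The arithmetic-geometric mean inequality for \<open>k^2 |y|\<close> and
      \<open>1 / k\<close> splits the term into one controlled by Bessel for \<open>f2\<close> and
      one that is summable by itself.\<close>
    have "2 * (real k * \<bar>y\<bar>) \<le> ((real k)\<^sup>2 * y)\<^sup>2 + 1 / (real k)\<^sup>2" for y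
      using sum_squares_bound[of "(real k)\<^sup>2 * \<bar>y\<bar>" "1 / real k"] False
      by (simp add: power_mult_distrib power_divide) (simp add: power2_eq_square)
    from aux[OF this[of "a k"] this[of "b k"]]
    have "real k * \<bar>a k\<bar> + real k * \<bar>b k\<bar> \<le> 1 / 2 * (((real k)\<^sup>2 * a k)\<^sup>2 + ((real k)\<^sup>2 * b k)\<^sup>2) + 1 / (real k)\<^sup>2" .
    also have "1 / 2 * (((real k)\<^sup>2 * a k)\<^sup>2 + ((real k)\<^sup>2 * b k)\<^sup>2) \<le> X k"
      unfolding X_def using pi_ge_two by (intro mult_mono) (auto simp: fourier_wt_def)
    finally show ?thesis by (simp add: M_def)
  qed
  obtain g1 where g1: "uniform_limit UNIV S1 g1 sequentially" "continuous_on UNIV g1"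
    "(\<lambda>N. \<integral>x. (S1 N x)\<^sup>2 \<partial>circ) \<longlonglongrightarrow> (\<integral>x. (g1 x)\<^sup>2 \<partial>circ)"
    "\<And>m. fourier_cos g1 m = real m * b m" "\<And>m. fourier_sin g1 m = - real m * a m"
    using trig_sum_uniform_limit[of "\<lambda>k. real k * b k" "\<lambda>k. - real k * a k" M] kM sM
    unfolding S1_def by (auto simp: abs_mult add.commute)
  have "AE x in circ. f1 x = g1 x"
    using integrable_circ_square_imp[OF f1] integrable_circ_continuous_UNIV[OF g1(2)]
    by (rule fourier_coeff_unique) (simp_all add: c g1)
  then have "AE x in circ. (g1 x)\<^sup>2 = (f1 x)\<^sup>2" by eventually_elim simp
  then have "(\<integral>x. (g1 x)\<^sup>2 \<partial>circ) = (\<integral>x. (f1 x)\<^sup>2 \<partial>circ)"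
    using f1 borel_measurable_integrable[OF integrable_circ_continuous_UNIV[OF g1(2)]]
    by (intro integral_cong_AE) auto
  then show "(\<lambda>N. \<integral>x. (S1 N x)\<^sup>2 \<partial>circ) \<longlonglongrightarrow> (\<integral>x. (f1 x)\<^sup>2 \<partial>circ)" using g1(3) by simp
  \<comment> \<open>\<open>M 0\<close> is 0, since \<open>X 0 = 0\<close> and
    \<open>1 / 0 = 0\<close>; the constant coefficient has to be added back.\<close>
  define M' where "M' k = M k + (if k = 0 then \<bar>a 0\<bar> else 0)" for k
  have sM': "summable M'" unfolding M'_def
    by (intro summable_add sM) (rule sums_summable[OF sums_single[of 0 "\<lambda>_. \<bar>a 0\<bar>"]])
  have kM': "\<bar>a k\<bar> + \<bar>b k\<bar> \<le> M' k" for k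
  proof (cases "k = 0")
    case True
    then show ?thesis using kM[of 0] by (simp add: M'_def b0)
  next
    case False
    then have "1 * (\<bar>a k\<bar> + \<bar>b k\<bar>) \<le> real k * (\<bar>a k\<bar> + \<bar>b k\<bar>)"
      by (intro mult_right_mono) auto
    then show ?thesis using kM[of k] False by (simp add: M'_def distrib_left)
  qed
  have fs: "fourier_sum f = trig_sum a b" by (simp add: fourier_sum_def a_def b_def)
  obtain g where g: "uniform_limit UNIV (fourier_sum f) g sequentially" "continuous_on UNIV g"
    "(\<lambda>N. \<integral>x. (fourier_sum f N x)\<^sup>2 \<partial>circ) \<longlonglongrightarrow> (\<integral>x. (g x)\<^sup>2 \<partial>circ)"
    "\<And>m. fourier_cos g m = a m" "\<And>m. fourier_sin g m = b m"
    using trig_sum_uniform_limit[of a b M', OF kM' sM'] b0 unfolding fs by auto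
  have "AE x in circ. f x = g x"
    using integrable_circ_continuous_UNIV[OF cf] integrable_circ_continuous_UNIV[OF g(2)]
    by (rule fourier_coeff_unique) (simp_all add: a_def b_def g)
  then have fg: "f x = g x" if "x \<in> {0..2*pi}" for x
    using AE_circ_continuous_eq[OF cf g(2)] that by blast
  show "uniform_limit {0..2*pi} (fourier_sum f) f sequentially"
    using uniform_limit_on_subset[OF g(1), of "{0..2*pi}"] fg
    by (subst uniform_limit_cong'[where i = g and g = "fourier_sum f"]) auto
  have "(\<integral>x. (g x)\<^sup>2 \<partial>circ) = (\<integral>x. (f x)\<^sup>2 \<partial>circ)"
    using fg by (intro Bochner_Integration.integral_cong) (auto simp: space_restrict_space)
  then show "(\<lambda>N. \<integral>x. (fourier_sum f N x)\<^sup>2 \<partial>circ) \<longlonglongrightarrow> (\<integral>x. (f x)\<^sup>2 \<partial>circ)" using g(3) by simp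
qed

lemma energy3_fourier_sum_le:
  assumes f: "circle_H2 f f1 f2" and "e > 0"
  shows "eventually (\<lambda>N. energy3 (fourier_sum f N)
      (trig_sum (\<lambda>k. real k * fourier_sin f k) (\<lambda>k. - real k * fourier_cos f k) N)
      (trig_sum (\<lambda>k. - (real k)\<^sup>2 * fourier_cos f k) (\<lambda>k. - (real k)\<^sup>2 * fourier_sin f k) N)
    \<le> energy3 f f1 f2 + e) sequentially"
proof -
  note L = H2_fourier_limits[OF f]
  let ?S1 = "trig_sum (\<lambda>k. real k * fourier_sin f k) (\<lambda>k. - real k * fourier_cos f k)"
  have "(\<lambda>N. - 10 * (\<integral>x. (?S1 N x)\<^sup>2 \<partial>circ) + 9 * (\<integral>x. (fourier_sum f N x)\<^sup>2 \<partial>circ))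
     \<longlonglongrightarrow> - 10 * (\<integral>x. (f1 x)\<^sup>2 \<partial>circ) + 9 * (\<integral>x. (f x)\<^sup>2 \<partial>circ)"
    by (intro tendsto_intros L)
  then have "eventually (\<lambda>N. - 10 * (\<integral>x. (?S1 N x)\<^sup>2 \<partial>circ) + 9 * (\<integral>x. (fourier_sum f N x)\<^sup>2 \<partial>circ) <
      - 10 * (\<integral>x. (f1 x)\<^sup>2 \<partial>circ) + 9 * (\<integral>x. (f x)\<^sup>2 \<partial>circ) + e) sequentially"
    by (rule order_tendstoD(2)) (use \<open>e > 0\<close> in simp)
  then show ?thesis
  proof eventually_elim
    case (elim N)
    then show ?case using L(4)[of N] unfolding energy3_def by linarith
  qed
qed

text \<open>The multiplier \<open>(k^2 - 1) (k^2 - 9)\<close> is 9 at 0, vanishes at 1 and 3 and is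
  positive beyond 3, so without the mode 2 only the constant mode is kept, with factor
  \<open>9 * 2 pi\<close>. Working with partial sums makes Parseval a finite identity; the error
  \<open>e\<close> is removed at the end.\<close>

lemma energy3_lower_bound:
  assumes f: "circle_H2 f f1 f2" and "fourier_cos f 2 = 0" "fourier_sin f 2 = 0"
  shows "energy3 f f1 f2 \<ge> 18 * pi * (fourier_cos f 0)\<^sup>2"
proof (rule field_le_epsilon)
  fix e :: real assume "e > 0"
  define a b where "a = fourier_cos f" and "b = fourier_sin f"
  have b0: "b 0 = 0" by (simp add: b_def)
  obtain N where N: "N \<ge> 1" "energy3 (trig_sum a b N) (trig_sum (\<lambda>k. real k * b k) (\<lambda>k. - real k * a k) N)
      (trig_sum (\<lambda>k. - (real k)\<^sup>2 * a k) (\<lambda>k. - (real k)\<^sup>2 * b k) N) \<le> energy3 f f1 f2 + e"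
    using eventually_happens'[OF sequentially_bot eventually_conj[OF energy3_fourier_sum_le[OF f \<open>e > 0\<close>] eventually_ge_at_top[of 1]]]
    unfolding a_def b_def fourier_sum_def by auto
  have "18 * pi * (a 0)\<^sup>2 = (\<Sum>k<N. if k = 0 then 18 * pi * (a 0)\<^sup>2 else 0)"
    using N(1) by simp
  also have "\<dots> \<le> (\<Sum>k<N. fourier_wt k * (((real k)\<^sup>2 - 1) * ((real k)\<^sup>2 - 9)) * ((a k)\<^sup>2 + (b k)\<^sup>2))"
  proof (rule sum_mono)
    fix k :: nat
    consider "k = 0" | "k = 1" | "k = 2" | "k \<ge> 3" by linarith
    then show "(if k = 0 then 18 * pi * (a 0)\<^sup>2 else 0) \<le>
       fourier_wt k * (((real k)\<^sup>2 - 1) * ((real k)\<^sup>2 - 9)) * ((a k)\<^sup>2 + (b k)\<^sup>2)"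
    proof cases
      case 4
      then have "(real k)\<^sup>2 \<ge> 3\<^sup>2" by (intro power_mono) auto
      then have "0 \<le> fourier_wt k * (((real k)\<^sup>2 - 1) * ((real k)\<^sup>2 - 9)) * ((a k)\<^sup>2 + (b k)\<^sup>2)"
        using fourier_wt_pos[of k] by (intro mult_nonneg_nonneg) auto
      then show ?thesis using 4 by simp
    qed (use assms in \<open>auto simp: b0 fourier_wt_def a_def b_def\<close>)
  qed
  also have "\<dots> = energy3 (trig_sum a b N) (trig_sum (\<lambda>k. real k * b k) (\<lambda>k. - real k * a k) N)
      (trig_sum (\<lambda>k. - (real k)\<^sup>2 * a k) (\<lambda>k. - (real k)\<^sup>2 * b k) N)"
    unfolding energy3_def
    by (simp add: trig_sum_Parseval b0 sum_distrib_left sum_subtractf[symmetric] sum.distrib[symmetric])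
       (intro sum.cong refl, simp add: algebra_simps power2_eq_square)
  finally show "18 * pi * (fourier_cos f 0)\<^sup>2 \<le> energy3 f f1 f2 + e"
    using N(2) by (simp add: a_def)
qed

section \<open>Conformal invariance of the energy\<close>

lemma continuous_antiderivative:
  fixes f :: "real \<Rightarrow> real"
  assumes "continuous_on UNIV f"
  obtains F where "\<And>x. (F has_real_derivative f x) (at x)"
proof -
  have "\<exists>F. \<forall>x::real. - \<infinity> < ereal x \<longrightarrow> ereal x < \<infinity> \<longrightarrow> (F has_vector_derivative f x) (at x)"
    using assms by (intro einterval_antiderivative) (auto simp: continuous_on_eq_continuous_at)
  then have "\<exists>F. \<forall>x. (F has_vector_derivative f x) (at x)" by simp
  then obtain F where F: "\<forall>x. (F has_vector_derivative f x) (at x)" by blast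
  show ?thesis
    by (rule that[of F]) (simp add: F has_real_derivative_iff_has_vector_derivative)
qed

text \<open>\<open>\<theta>\<close> carries the period to a shifted period starting at
  \<open>\<theta> 0\<close>. The integral of \<open>f\<close> over a full period is independent of
  its starting point, because \<open>F (x + 2 * pi) - F x\<close> has derivative 0.\<close>

lemma circ_integral_substitution:
  fixes f \<theta> w :: "real \<Rightarrow> real"
  assumes f: "continuous_on UNIV f" "\<And>x. f (x + 2 * pi) = f x"
    and \<theta>: "\<And>t. (\<theta> has_real_derivative w t) (at t)" "\<theta> (2 * pi) = \<theta> 0 + 2 * pi"
    and w: "continuous_on UNIV w"
  shows "(\<integral>t. f (\<theta> t) * w t \<partial>circ) = (\<integral>x. f x \<partial>circ)"
proof -
  obtain F where F: "\<And>x. (F has_real_derivative f x) (at x)"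
    using continuous_antiderivative[OF f(1)] by blast
  have c\<theta>: "continuous_on UNIV \<theta>"
    using \<theta>(1) by (meson DERIV_isCont continuous_at_imp_continuous_on)
  have "((\<lambda>x. F (x + 2 * pi) - F x) has_real_derivative 0) (at x)" for x
    using f(2)[of x] by (auto intro!: derivative_eq_intros DERIV_chain2[OF F])
  then have per: "F (x + 2 * pi) - F x = F (0 + 2 * pi) - F 0" for x
    using DERIV_isconst_all[of "\<lambda>x. F (x + 2 * pi) - F x" x 0] by simp
  have "(\<integral>t. f (\<theta> t) * w t \<partial>circ) = F (\<theta> (2 * pi)) - F (\<theta> 0)"
  proof (rule circ_integral_FTC[where F = "\<lambda>t. F (\<theta> t)"])
    show "((\<lambda>t. F (\<theta> t)) has_real_derivative f (\<theta> t) * w t) (at t)" for t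
      by (rule DERIV_chain2[OF F \<theta>(1)])
    show "continuous_on UNIV (\<lambda>t. f (\<theta> t) * w t)"
      by (intro continuous_intros continuous_on_compose2[OF f(1) c\<theta>] w) auto
  qed
  also have "\<dots> = F (2 * pi) - F 0" using per[of "\<theta> 0"] \<theta>(2) by simp
  also have "\<dots> = (\<integral>x. f x \<partial>circ)"
    by (rule circ_integral_FTC[OF F f(1), symmetric])
  finally show ?thesis .
qed

definition circle_C2 :: "(real \<Rightarrow> real) \<Rightarrow> (real \<Rightarrow> real) \<Rightarrow> (real \<Rightarrow> real) \<Rightarrow> bool" where
  "circle_C2 u u1 u2 \<longleftrightarrow> (\<forall>x. (u has_real_derivative u1 x) (at x)) \<and>
     (\<forall>x. (u1 has_real_derivative u2 x) (at x)) \<and> continuous_on UNIV u2 \<and>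
     (\<forall>x. u (x + 2 * pi) = u x) \<and> (\<forall>x. u1 (x + 2 * pi) = u1 x) \<and> (\<forall>x. u2 (x + 2 * pi) = u2 x)"

lemma circle_C2_continuous:
  assumes "circle_C2 u u1 u2"
  shows "continuous_on UNIV u" "continuous_on UNIV u1" "continuous_on UNIV u2"
  using assms unfolding circle_C2_def by (meson DERIV_isCont continuous_at_imp_continuous_on)+

lemma fourier_derivative:
  assumes u: "\<And>x. (u has_real_derivative u1 x) (at x)" "continuous_on UNIV u1" "u (2 * pi) = u 0"
  shows "fourier_cos u1 k = real k * fourier_sin u k" "fourier_sin u1 k = - real k * fourier_cos u k"
proof -
  have cu: "continuous_on UNIV u"
    using u(1) by (meson DERIV_isCont continuous_at_imp_continuous_on)
  have per: "cos (real k * (2 * pi)) = 1" "sin (real k * (2 * pi)) = 0"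
    using cos_int_2pin[of "int k"] sin_int_2pin[of "int k"] by (auto simp: mult_ac)
  have i: "integrable circ (\<lambda>x. v x * cos (real k * x))" "integrable circ (\<lambda>x. v x * sin (real k * x))"
    if "continuous_on UNIV v" for v
    by (intro integrable_circ_continuous_UNIV continuous_intros that)+
  have "(\<integral>x. u1 x * cos (real k * x) - real k * (u x * sin (real k * x)) \<partial>circ) =
     u (2 * pi) * cos (real k * (2 * pi)) - u 0 * cos (real k * 0)"
    by (intro circ_integral_FTC[where F = "\<lambda>x. u x * cos (real k * x)"])
       (auto intro!: derivative_eq_intros u continuous_intros cu)
  then show "fourier_cos u1 k = real k * fourier_sin u k"
    using u(3) i[OF cu] i[OF u(2)] by (simp add: per fourier_cos_def fourier_sin_def)
  have "(\<integral>x. u1 x * sin (real k * x) + real k * (u x * cos (real k * x)) \<partial>circ) =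
     u (2 * pi) * sin (real k * (2 * pi)) - u 0 * sin (real k * 0)"
    by (intro circ_integral_FTC[where F = "\<lambda>x. u x * sin (real k * x)"])
       (auto intro!: derivative_eq_intros u continuous_intros cu)
  then have "(\<integral>x. u1 x * sin (real k * x) \<partial>circ) = - real k * (\<integral>x. u x * cos (real k * x) \<partial>circ)"
    using u(3) i[OF cu] i[OF u(2)] by (simp add: per)
  then show "fourier_sin u1 k = - real k * fourier_cos u k"
    by (simp add: fourier_cos_def fourier_sin_def)
qed

lemma circle_C2_imp_H2:
  assumes "circle_C2 u u1 u2"
  shows "circle_H2 u u1 u2"
proof -
  note c = circle_C2_continuous[OF assms]
  have u: "\<And>x. (u has_real_derivative u1 x) (at x)" "\<And>x. (u1 has_real_derivative u2 x) (at x)"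
    "u (2 * pi) = u 0" "u1 (2 * pi) = u1 0"
    using assms unfolding circle_C2_def by (auto dest: spec[of _ 0])
  have "v \<in> borel_measurable circ" "integrable circ (\<lambda>x. (v x)\<^sup>2)" if "continuous_on UNIV v" for v :: "real \<Rightarrow> real"
    by (intro borel_measurable_integrable integrable_circ_continuous_UNIV continuous_intros that)+
  then show ?thesis
    using c fourier_derivative[OF u(1) c(2) u(3)] fourier_derivative[OF u(2) c(3) u(4)]
    by (auto simp: circle_H2_def power2_eq_square)
qed

text \<open>The pointwise identity behind conformal invariance, stripped to algebra:
  \<open>r\<close>, \<open>s\<close>, \<open>k\<close> stand for \<open>\<rho>\<close>, its
  derivative and \<open>1 / \<rho>\<close>, the letters \<open>a\<close>, \<open>b\<close>,
  \<open>c\<close> for \<open>u\<close>, \<open>u1\<close>, \<open>u2\<close> at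
  \<open>\<theta> t\<close>, and \<open>k^3 - r\<close> for the second derivative of
  \<open>\<rho>\<close>. The left side is the derivative of the boundary form \<open>S\<close> of
  the next lemma, term by term.\<close>

lemma energy_density_identity:
  fixes r s k a b c :: real
  assumes "k * r = 1"
  shows "(36 * r^2 * s^4 + 12 * r^3 * (3 * s^2 * (k^3 - r)) - 90 * r^4 * s^2 - 18 * r^5 * (k^3 - r)) * a^2
     + 2 * (12 * r^3 * s^3 - 18 * r^5 * s) * a * (b * k^2)
     + (24 * r * s * s^2 + 24 * r^2 * s * (k^3 - r) - 24 * r^3 * s) * (a * b)
     + (12 * r^2 * s^2 + 6 - 6 * r^4) * (b * k^2 * b + a * (c * k^2))
     + (4 * s * s + 4 * r * (k^3 - r)) * b^2 + 8 * r * s * b * (c * k^2)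
   = ((6 * r * s^2 + 3 * k - 3 * r^3) * a + 4 * s * b + c * k)^2
      - 10 * (3 * r^2 * s * a + r * b)^2 + 9 * (r^3 * a)^2 - (c^2 - 10 * b^2 + 9 * a^2) * k^2"
  using assms by algebra
text \<open>The pullback \<open>\<rho>\<^sup>3 (u \<circ> \<theta>)\<close> of a density of weight \<open>-3/2\<close> under the projective
  transformation \<open>\<theta>\<close>; here \<open>\<rho>\<close> solves \<open>\<rho>'' + \<rho> = \<rho>\<^sup>-\<^sup>3\<close>. The two energy densities differ by
  the derivative of a quadratic form in \<open>u\<close>, \<open>u'\<close>.\<close>

lemma conformal_pullback:
  fixes \<rho> \<sigma> \<theta> u u1 u2 :: "real \<Rightarrow> real"
  assumes pos: "\<And>t. \<rho> t > 0"
    and \<rho>: "\<And>t. (\<rho> has_real_derivative \<sigma> t) (at t)"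
    and \<sigma>: "\<And>t. (\<sigma> has_real_derivative (1 / \<rho> t ^ 3 - \<rho> t)) (at t)"
    and \<theta>: "\<And>t. (\<theta> has_real_derivative 1 / (\<rho> t)\<^sup>2) (at t)"
    and per: "\<And>t. \<rho> (t + 2 * pi) = \<rho> t" "\<And>t. \<sigma> (t + 2 * pi) = \<sigma> t" "\<And>t. \<theta> (t + 2 * pi) = \<theta> t + 2 * pi"
    and u: "circle_C2 u u1 u2"
  defines "v \<equiv> \<lambda>t. \<rho> t ^ 3 * u (\<theta> t)"
    and "v1 \<equiv> \<lambda>t. 3 * (\<rho> t)\<^sup>2 * \<sigma> t * u (\<theta> t) + \<rho> t * u1 (\<theta> t)"
    and "v2 \<equiv> \<lambda>t. (6 * \<rho> t * (\<sigma> t)\<^sup>2 + 3 / \<rho> t - 3 * \<rho> t ^ 3) * u (\<theta> t) + 4 * \<sigma> t * u1 (\<theta> t) + u2 (\<theta> t) / \<rho> t"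
  shows "circle_C2 v v1 v2" and "energy3 v v1 v2 = energy3 u u1 u2"
proof -
  have du: "(u has_real_derivative u1 x) (at x)" "(u1 has_real_derivative u2 x) (at x)" for x
    using u by (auto simp: circle_C2_def)
  have pu: "u (x + 2 * pi) = u x" "u1 (x + 2 * pi) = u1 x" "u2 (x + 2 * pi) = u2 x" for x
    using u by (auto simp: circle_C2_def)
  have du\<theta>: "((\<lambda>t. u (\<theta> t)) has_real_derivative u1 (\<theta> t) * (1 / (\<rho> t)\<^sup>2)) (at t)"
    "((\<lambda>t. u1 (\<theta> t)) has_real_derivative u2 (\<theta> t) * (1 / (\<rho> t)\<^sup>2)) (at t)" for t
    by (rule DERIV_chain2[OF du(1) \<theta>] DERIV_chain2[OF du(2) \<theta>])+
  have c: "continuous_on UNIV \<rho>" "continuous_on UNIV \<sigma>" "continuous_on UNIV \<theta>"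
    using \<rho> \<sigma> \<theta> by (meson DERIV_isCont continuous_at_imp_continuous_on)+
  have cu: "continuous_on UNIV (\<lambda>t. u (\<theta> t))" "continuous_on UNIV (\<lambda>t. u1 (\<theta> t))" "continuous_on UNIV (\<lambda>t. u2 (\<theta> t))"
    by (rule continuous_on_compose2[OF circle_C2_continuous(1)[OF u] c(3)]
        continuous_on_compose2[OF circle_C2_continuous(2)[OF u] c(3)]
        continuous_on_compose2[OF circle_C2_continuous(3)[OF u] c(3)], simp)+
  have nz: "\<rho> t \<noteq> 0" for t using pos[of t] by simp
  have nz': "\<forall>t\<in>UNIV. \<rho> t \<noteq> 0" using nz by simp
  have dv: "(v has_real_derivative v1 t) (at t)" for t
    unfolding v_def v1_def using nz[of t]
    by (auto intro!: derivative_eq_intros \<rho> du\<theta> simp: power2_eq_square power3_eq_cube)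
  have dv1: "(v1 has_real_derivative v2 t) (at t)" for t
    unfolding v1_def v2_def using nz[of t]
    by (auto intro!: derivative_eq_intros \<rho> \<sigma> du\<theta> simp: power2_eq_square power3_eq_cube field_simps)
  have cv2: "continuous_on UNIV v2"
    unfolding v2_def by (intro continuous_intros c cu nz')
  show C2: "circle_C2 v v1 v2"
    unfolding circle_C2_def using dv dv1 cv2
    by (auto simp: v_def v1_def v2_def per pu)
  note cv = circle_C2_continuous[OF C2]
  define E where "E x = (u2 x)\<^sup>2 - 10 * (u1 x)\<^sup>2 + 9 * (u x)\<^sup>2" for x
  \<comment> \<open>The coefficients of \<open>u1^2\<close> and \<open>u u1\<close> are read off
    from the terms of \<open>v2^2\<close> that are linear in \<open>u2\<close>, as
    \<open>u1 (\<theta> t)\<close> has derivative \<open>u2 (\<theta> t) / (\<rho> t)^2\<close>; the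
    coefficient of \<open>u^2\<close> is then forced by the \<open>u u1\<close> terms.\<close>
  define S where "S t = (12 * \<rho> t ^ 3 * \<sigma> t ^ 3 - 18 * \<rho> t ^ 5 * \<sigma> t) * (u (\<theta> t))\<^sup>2
     + (12 * (\<rho> t)\<^sup>2 * (\<sigma> t)\<^sup>2 + 6 - 6 * \<rho> t ^ 4) * (u (\<theta> t) * u1 (\<theta> t)) + 4 * \<rho> t * \<sigma> t * (u1 (\<theta> t))\<^sup>2" for t
  define G where "G t = (v2 t)\<^sup>2 - 10 * (v1 t)\<^sup>2 + 9 * (v t)\<^sup>2 - E (\<theta> t) * (1 / (\<rho> t)\<^sup>2)" for t
  have dS: "(S has_real_derivative G t) (at t)" for t
  proof -
    define k where "k = 1 / \<rho> t"
    have k: "k * \<rho> t = 1" using nz[of t] by (simp add: k_def)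
    have d: "1 / (\<rho> t)\<^sup>2 = k\<^sup>2" "1 / \<rho> t ^ 3 = k ^ 3" "3 / \<rho> t = 3 * k" "u2 (\<theta> t) / \<rho> t = u2 (\<theta> t) * k"
      by (auto simp: k_def power_divide)
    note rules = derivative_eq_intros \<rho> \<sigma>[of t, unfolded d] du\<theta>[of t, unfolded d] refl
    show ?thesis
      unfolding S_def G_def E_def v_def v1_def v2_def d
      by (rule rules)+ (rule trans[OF _ energy_density_identity[OF k]],
          simp add: eval_nat_numeral algebra_simps)
  qed
  have cE: "continuous_on UNIV E"
    unfolding E_def by (intro continuous_intros circle_C2_continuous[OF u])
  have cE\<theta>: "continuous_on UNIV (\<lambda>t. E (\<theta> t))"
    by (rule continuous_on_compose2[OF cE c(3)]) simp
  have cG: "continuous_on UNIV G"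
    unfolding G_def using nz' by (intro continuous_intros cv cE\<theta> c) auto
  have "\<theta> (2 * pi) = \<theta> 0 + 2 * pi" "S (2 * pi) = S 0"
    using per(3)[of 0] per(1,2)[of 0] pu[of "\<theta> 0"] by (simp_all add: S_def)
  then have "(\<integral>t. G t \<partial>circ) = 0"
    using circ_integral_FTC[OF dS cG] by simp
  moreover have "(\<integral>t. G t \<partial>circ) = energy3 v v1 v2 - (\<integral>t. E (\<theta> t) * (1 / (\<rho> t)\<^sup>2) \<partial>circ)"
  proof -
    have "integrable circ (\<lambda>t. (v2 t)\<^sup>2)" "integrable circ (\<lambda>t. (v1 t)\<^sup>2)" "integrable circ (\<lambda>t. (v t)\<^sup>2)"
      "integrable circ (\<lambda>t. E (\<theta> t) * (1 / (\<rho> t)\<^sup>2))"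
      using nz' by (auto intro!: integrable_circ_continuous_UNIV continuous_intros cv cE\<theta> c)
    then show ?thesis unfolding G_def energy3_def by simp
  qed
  moreover have "(\<integral>t. E (\<theta> t) * (1 / (\<rho> t)\<^sup>2) \<partial>circ) = (\<integral>x. E x \<partial>circ)"
    using nz' \<open>\<theta> (2 * pi) = \<theta> 0 + 2 * pi\<close>
    by (intro circ_integral_substitution cE \<theta>) (auto simp: E_def pu intro!: continuous_intros c)
  moreover have "(\<integral>x. E x \<partial>circ) = energy3 u u1 u2"
  proof -
    have "integrable circ (\<lambda>t. (u2 t)\<^sup>2)" "integrable circ (\<lambda>t. (u1 t)\<^sup>2)" "integrable circ (\<lambda>t. (u t)\<^sup>2)"
      by (auto intro!: integrable_circ_continuous_UNIV continuous_intros circle_C2_continuous[OF u])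
    then show ?thesis unfolding E_def energy3_def by simp
  qed
  ultimately show "energy3 v v1 v2 = energy3 u u1 u2" by simp
qed

section \<open>The projective transformations\<close>

text \<open>Half the trace of the positive definite symmetric matrix of determinant 1 with
  parameters \<open>q\<close>, \<open>r\<close>. By polar decomposition a general element of
  \<open>SL(2, R)\<close> differs from such a matrix by a rotation, and rotating the variable leaves
  the mean unchanged; two parameters therefore suffice.\<close>

definition conf_p :: "real \<Rightarrow> real \<Rightarrow> real" where
  "conf_p q r = sqrt (1 + q\<^sup>2 + r\<^sup>2)"

text \<open>\<open>(conf_D, conf_N)\<close> are the radial and tangential components of \<open>A (cos t, sin t)\<close> for the
  symmetric matrix \<open>A = ((p + q, r), (r, p - q))\<close>, which has determinant \<open>1\<close>; \<open>conf_rho\<close> is the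
  length of this vector and \<open>conf_theta\<close> a continuous choice of its angle.\<close>

definition conf_D :: "real \<Rightarrow> real \<Rightarrow> real \<Rightarrow> real" where
  "conf_D q r t = conf_p q r + q * cos (2 * t) + r * sin (2 * t)"

definition conf_N :: "real \<Rightarrow> real \<Rightarrow> real \<Rightarrow> real" where
  "conf_N q r t = r * cos (2 * t) - q * sin (2 * t)"

definition conf_rho :: "real \<Rightarrow> real \<Rightarrow> real \<Rightarrow> real" where
  "conf_rho q r t = sqrt ((conf_D q r t)\<^sup>2 + (conf_N q r t)\<^sup>2)"

definition conf_sigma :: "real \<Rightarrow> real \<Rightarrow> real \<Rightarrow> real" where
  "conf_sigma q r t = 2 * conf_p q r * conf_N q r t / conf_rho q r t"

definition conf_theta :: "real \<Rightarrow> real \<Rightarrow> real \<Rightarrow> real" where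
  "conf_theta q r t = t + arctan (conf_N q r t / conf_D q r t)"

definition weight :: "real \<Rightarrow> real \<Rightarrow> real \<Rightarrow> real" where
  "weight Q R x = conf_p Q R - Q * cos (2 * x) - R * sin (2 * x)"

lemma conf_p_pos: "conf_p q r > 0"
  unfolding conf_p_def by (simp add: add_pos_nonneg)

lemma conf_p_square: "(conf_p q r)\<^sup>2 = 1 + q\<^sup>2 + r\<^sup>2"
  unfolding conf_p_def by simp

lemma conf_p_gt: "\<bar>q * cos s + r * sin s\<bar> < conf_p q r"
proof -
  have "(q * cos s + r * sin s)\<^sup>2 + (q * sin s - r * cos s)\<^sup>2 = q\<^sup>2 * ((cos s)\<^sup>2 + (sin s)\<^sup>2) + r\<^sup>2 * ((cos s)\<^sup>2 + (sin s)\<^sup>2)"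
    by algebra
  then have "(q * cos s + r * sin s)\<^sup>2 + (q * sin s - r * cos s)\<^sup>2 = q\<^sup>2 + r\<^sup>2" by simp
  then have "(q * cos s + r * sin s)\<^sup>2 < (conf_p q r)\<^sup>2"
    unfolding conf_p_square using zero_le_power2[of "q * sin s - r * cos s"] by linarith
  then show ?thesis using conf_p_pos[of q r] by (metis abs_of_pos power2_less_imp_less power2_abs less_imp_le)
qed

lemma weight_pos: "weight Q R x > 0"
  using conf_p_gt[of Q "2 * x" R] unfolding weight_def by linarith

text \<open>Positive definiteness of the matrix: a vector is turned by less than a right angle, so
  the \<open>arctan\<close> in \<open>conf_theta\<close> gives the angle without jumps.\<close>

lemma conf_D_pos: "conf_D q r t > 0"
  using conf_p_gt[of q "2 * t" r] unfolding conf_D_def by linarith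

lemma conf_rho_square: "(conf_rho q r t)\<^sup>2 = (conf_D q r t)\<^sup>2 + (conf_N q r t)\<^sup>2"
  unfolding conf_rho_def by simp

lemma conf_rho_pos: "conf_rho q r t > 0"
  unfolding conf_rho_def using conf_D_pos[of q r t] by (simp add: add_pos_nonneg)

text \<open>Cayley-Hamilton: \<open>A^2 = 2 p A - 1\<close>, evaluated as a quadratic form at a unit
  vector.\<close>

lemma conf_rho_square': "(conf_rho q r t)\<^sup>2 = 2 * conf_p q r * conf_D q r t - 1"
  unfolding conf_rho_square using conf_p_square[of q r] sin_cos_squared_add[of "2 * t"]
  unfolding conf_D_def conf_N_def by algebra

section \<open>Differential equations for length and angle\<close>

lemma conf_D_deriv: "(conf_D q r has_real_derivative 2 * conf_N q r t) (at t)"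
  unfolding conf_D_def conf_N_def by (auto intro!: derivative_eq_intros simp: algebra_simps)

lemma conf_N_deriv: "(conf_N q r has_real_derivative - 2 * (conf_D q r t - conf_p q r)) (at t)"
  unfolding conf_D_def conf_N_def by (auto intro!: derivative_eq_intros simp: algebra_simps)

lemma conf_rho_deriv: "(conf_rho q r has_real_derivative conf_sigma q r t) (at t)"
proof -
  have e: "conf_rho q r = (\<lambda>t. sqrt (2 * conf_p q r * conf_D q r t - 1))"
    using conf_rho_pos[of q r] by (intro ext) (simp add: conf_rho_square'[symmetric] less_imp_le)
  have "2 * conf_p q r * conf_D q r t - 1 > 0"
    using conf_rho_pos[of q r t] by (simp add: conf_rho_square'[symmetric])
  then have "((\<lambda>t. sqrt (2 * conf_p q r * conf_D q r t - 1)) has_real_derivative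
      (2 * conf_p q r * (2 * conf_N q r t)) * (inverse (sqrt (2 * conf_p q r * conf_D q r t - 1)) / 2)) (at t)"
    by (auto intro!: derivative_eq_intros conf_D_deriv)
  moreover have "(2 * conf_p q r * (2 * conf_N q r t)) * (inverse (sqrt (2 * conf_p q r * conf_D q r t - 1)) / 2)
      = conf_sigma q r t"
  proof -
    have s: "sqrt (2 * conf_p q r * conf_D q r t - 1) = conf_rho q r t" by (simp only: e)
    show ?thesis unfolding s conf_sigma_def by (simp add: field_simps)
  qed
  ultimately show ?thesis by (subst e) simp
qed

text \<open>The vector \<open>A (cos t, sin t)\<close> solves \<open>y'' = - y\<close> with angular
  momentum \<open>det A = 1\<close>; this is the radial equation
  \<open>\<rho>'' + \<rho> = 1 / \<rho>^3\<close> of that motion.\<close>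

lemma conf_sigma_deriv:
  "(conf_sigma q r has_real_derivative (1 / conf_rho q r t ^ 3 - conf_rho q r t)) (at t)"
proof -
  let ?\<rho> = "conf_rho q r t" and ?p = "conf_p q r" and ?N = "conf_N q r t" and ?D = "conf_D q r t"
  have nz: "?\<rho> \<noteq> 0" using conf_rho_pos[of q r t] by simp
  have "(conf_sigma q r has_real_derivative
     ((2 * ?p * (- 2 * (?D - ?p))) * ?\<rho> - 2 * ?p * ?N * conf_sigma q r t) / (?\<rho> * ?\<rho>)) (at t)"
    unfolding conf_sigma_def[abs_def] 
    by (auto intro!: derivative_eq_intros conf_N_deriv conf_rho_deriv simp: nz conf_sigma_def)
  moreover have "((2 * ?p * (- 2 * (?D - ?p))) * ?\<rho> - 2 * ?p * ?N * conf_sigma q r t) / (?\<rho> * ?\<rho>) = 1 / ?\<rho> ^ 3 - ?\<rho>"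
  proof -
    have "(2 * ?p * (- 2 * (?D - ?p))) * ?\<rho> * ?\<rho> - 2 * ?p * ?N * (2 * ?p * ?N) = 1 - ?\<rho> ^ 4"
      using conf_rho_square'[of q r t] conf_rho_square[of q r t] by algebra
    then show ?thesis using nz
      by (simp add: conf_sigma_def field_simps eval_nat_numeral)
  qed
  ultimately show ?thesis by simp
qed

text \<open>Conservation of angular momentum: the squared length times the angular velocity is
  \<open>det A = 1\<close>.\<close>

lemma conf_theta_deriv: "(conf_theta q r has_real_derivative 1 / (conf_rho q r t)\<^sup>2) (at t)"
proof -
  let ?p = "conf_p q r" and ?N = "conf_N q r t" and ?D = "conf_D q r t"
  have nz: "?D \<noteq> 0" using conf_D_pos[of q r t] by simp
  have "(conf_theta q r has_real_derivative
     1 + ((- 2 * (?D - ?p)) * ?D - ?N * (2 * ?N)) / (?D * ?D) / (1 + (?N / ?D)\<^sup>2)) (at t)"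
  proof -
    have "((\<lambda>t. conf_N q r t / conf_D q r t) has_real_derivative
       ((- 2 * (?D - ?p)) * ?D - ?N * (2 * ?N)) / (?D * ?D)) (at t)"
      by (rule DERIV_divide[OF conf_N_deriv conf_D_deriv nz])
    from DERIV_chain2[where f = arctan, OF DERIV_arctan this]
    have "((\<lambda>t. arctan (conf_N q r t / conf_D q r t)) has_real_derivative
       ((- 2 * (?D - ?p)) * ?D - ?N * (2 * ?N)) / (?D * ?D) / (1 + (?N / ?D)\<^sup>2)) (at t)"
      by (simp only: divide_inverse mult_ac)
    from DERIV_add[OF DERIV_ident this] show ?thesis
      unfolding conf_theta_def[abs_def] .
  qed
  moreover have "1 + ((- 2 * (?D - ?p)) * ?D - ?N * (2 * ?N)) / (?D * ?D) / (1 + (?N / ?D)\<^sup>2) = 1 / (conf_rho q r t)\<^sup>2"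
  proof -
    have "?D * ?D * (1 + (?N / ?D)\<^sup>2) = (conf_rho q r t)\<^sup>2"
    proof -
      have "d * d * (1 + x\<^sup>2) = d\<^sup>2 + (d * x)\<^sup>2" for d x :: real
        by algebra
      from this[of ?D "?N / ?D"] show ?thesis
        using nz by (simp only: conf_rho_square nonzero_mult_div_cancel_left times_divide_eq_right not_False_eq_True)
    qed
    then have "1 + ((- 2 * (?D - ?p)) * ?D - ?N * (2 * ?N)) / (?D * ?D) / (1 + (?N / ?D)\<^sup>2) =
       1 + ((- 2 * (?D - ?p)) * ?D - ?N * (2 * ?N)) / (conf_rho q r t)\<^sup>2"
      by (simp only: divide_divide_eq_left)
    also have "\<dots> = ((conf_rho q r t)\<^sup>2 + ((- 2 * (?D - ?p)) * ?D - ?N * (2 * ?N))) / (conf_rho q r t)\<^sup>2"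
      using conf_rho_pos[of q r t] by (simp add: add_divide_distrib)
    also have "(conf_rho q r t)\<^sup>2 + ((- 2 * (?D - ?p)) * ?D - ?N * (2 * ?N)) = 1"
      using conf_rho_square'[of q r t] conf_rho_square[of q r t] by algebra
    finally show ?thesis .
  qed
  ultimately show ?thesis by simp
qed

lemma double_periodic: "cos (2 * (t + 2 * pi)) = cos (2 * t)" "sin (2 * (t + 2 * pi)) = sin (2 * t)"
  using cos_periodic[of "2 * t + 2 * pi"] cos_periodic[of "2 * t"]
    sin_periodic[of "2 * t + 2 * pi"] sin_periodic[of "2 * t"] by (simp_all add: algebra_simps)

lemma conf_periodic:
  "conf_D q r (t + 2 * pi) = conf_D q r t" "conf_N q r (t + 2 * pi) = conf_N q r t"
  "conf_rho q r (t + 2 * pi) = conf_rho q r t" "conf_sigma q r (t + 2 * pi) = conf_sigma q r t"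
  "conf_theta q r (t + 2 * pi) = conf_theta q r t + 2 * pi"
  "weight q r (t + 2 * pi) = weight q r t"
  unfolding conf_theta_def conf_sigma_def conf_rho_def conf_D_def conf_N_def weight_def double_periodic
  by simp_all

text \<open>In complex notation the image vector is \<open>(D + i N) exp (i t)\<close>, of modulus
  \<open>\<rho>\<close> and angle \<open>\<theta>\<close>; the two formulas are the real and
  imaginary parts of its square.\<close>

lemma conf_theta_double:
  defines "p \<equiv> conf_p"
  shows "(conf_rho q r t)\<^sup>2 * cos (2 * conf_theta q r t) =
     2 * p q r * q + (1 + 2 * q\<^sup>2) * cos (2 * t) + 2 * q * r * sin (2 * t)" (is ?C)
   and "(conf_rho q r t)\<^sup>2 * sin (2 * conf_theta q r t) =
     2 * p q r * r + 2 * q * r * cos (2 * t) + (1 + 2 * r\<^sup>2) * sin (2 * t)" (is ?S)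
proof -
  let ?N = "conf_N q r t" and ?D = "conf_D q r t"
  define \<delta> where "\<delta> = arctan (?N / ?D)"
  have nz: "?D \<noteq> 0" using conf_D_pos[of q r t] by simp
  have sq: "1 + (?N / ?D)\<^sup>2 = (conf_rho q r t)\<^sup>2 / ?D\<^sup>2"
    using nz by (simp add: conf_rho_square power_divide field_simps)
  have "sqrt (1 + (?N / ?D)\<^sup>2) = conf_rho q r t / ?D"
    using conf_D_pos[of q r t] conf_rho_pos[of q r t] by (simp add: sq real_sqrt_divide)
  then have cs: "cos \<delta> = ?D / conf_rho q r t" "sin \<delta> = ?N / conf_rho q r t"
    using nz by (simp_all add: \<delta>_def cos_arctan sin_arctan)
  have c2: "(conf_rho q r t)\<^sup>2 * cos (2 * \<delta>) = ?D\<^sup>2 - ?N\<^sup>2"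
    "(conf_rho q r t)\<^sup>2 * sin (2 * \<delta>) = 2 * ?D * ?N"
    unfolding cos_double sin_double cs
    using conf_rho_pos[of q r t] by (simp_all add: power_divide field_simps power2_eq_square)
  have th: "2 * conf_theta q r t = 2 * t + 2 * \<delta>"
    by (simp add: conf_theta_def \<delta>_def)
  have "(conf_rho q r t)\<^sup>2 * cos (2 * conf_theta q r t) = cos (2 * t) * ((conf_rho q r t)\<^sup>2 * cos (2 * \<delta>)) - sin (2 * t) * ((conf_rho q r t)\<^sup>2 * sin (2 * \<delta>))"
    unfolding th cos_add by (simp add: algebra_simps)
  also have "\<dots> = cos (2 * t) * (?D\<^sup>2 - ?N\<^sup>2) - sin (2 * t) * (2 * ?D * ?N)" by (simp only: c2)
  also have "\<dots> = 2 * p q r * q + (1 + 2 * q\<^sup>2) * cos (2 * t) + 2 * q * r * sin (2 * t)"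
    using conf_p_square[of q r] sin_cos_squared_add[of "2 * t"]
    unfolding conf_D_def conf_N_def p_def by algebra
  finally show ?C .
  have "(conf_rho q r t)\<^sup>2 * sin (2 * conf_theta q r t) = sin (2 * t) * ((conf_rho q r t)\<^sup>2 * cos (2 * \<delta>)) + cos (2 * t) * ((conf_rho q r t)\<^sup>2 * sin (2 * \<delta>))"
    unfolding th sin_add by (simp add: algebra_simps)
  also have "\<dots> = sin (2 * t) * (?D\<^sup>2 - ?N\<^sup>2) + cos (2 * t) * (2 * ?D * ?N)" by (simp only: c2)
  also have "\<dots> = 2 * p q r * r + 2 * q * r * cos (2 * t) + (1 + 2 * r\<^sup>2) * sin (2 * t)"
    using conf_p_square[of q r] sin_cos_squared_add[of "2 * t"]
    unfolding conf_D_def conf_N_def p_def by algebra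
  finally show ?S .
qed

text \<open>The square \<open>A^2 = 2 p A - 1\<close> has parameters \<open>2 p q\<close> and
  \<open>2 p r\<close>, and half its trace is \<open>2 p^2 - 1\<close>.\<close>

lemma conf_p_double:
  "conf_p (2 * conf_p q r * q) (2 * conf_p q r * r) = 1 + 2 * (q\<^sup>2 + r\<^sup>2)"
proof -
  have "1 + (2 * conf_p q r * q)\<^sup>2 + (2 * conf_p q r * r)\<^sup>2 = (1 + 2 * (q\<^sup>2 + r\<^sup>2))\<^sup>2"
    using conf_p_square[of q r] by algebra
  then show ?thesis unfolding conf_p_def[of "2 * _ * _"] by simp
qed

text \<open>With the parameters of \<open>A^2\<close>, \<open>weight\<close> at the angle
  \<open>x\<close> is the squared length of \<open>A^(-1) (cos x, sin x)\<close>. At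
  \<open>x = \<theta> t\<close> this unit vector is \<open>A (cos t, sin t) / \<rho>\<close>, which
  \<open>A^(-1)\<close> sends back to a vector of length \<open>1 / \<rho>\<close>.\<close>

lemma weight_conf_theta:
  "weight (2 * conf_p q r * q) (2 * conf_p q r * r) (conf_theta q r t) = 1 / (conf_rho q r t)\<^sup>2"
proof -
  let ?p = "conf_p q r"
  have "(conf_rho q r t)\<^sup>2 * weight (2 * ?p * q) (2 * ?p * r) (conf_theta q r t) =
    (1 + 2 * (q\<^sup>2 + r\<^sup>2)) * (conf_rho q r t)\<^sup>2
     - 2 * ?p * q * ((conf_rho q r t)\<^sup>2 * cos (2 * conf_theta q r t)) - 2 * ?p * r * ((conf_rho q r t)\<^sup>2 * sin (2 * conf_theta q r t))"
    unfolding weight_def conf_p_double by (simp add: algebra_simps)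
  also have "\<dots> = (1 + 2 * (q\<^sup>2 + r\<^sup>2)) * (2 * ?p * (?p + q * cos (2 * t) + r * sin (2 * t)) - 1)
     - 2 * ?p * q * (2 * ?p * q + (1 + 2 * q\<^sup>2) * cos (2 * t) + 2 * q * r * sin (2 * t))
     - 2 * ?p * r * (2 * ?p * r + 2 * q * r * cos (2 * t) + (1 + 2 * r\<^sup>2) * sin (2 * t))"
    unfolding conf_theta_double by (simp only: conf_rho_square' conf_D_def)
  also have "\<dots> = 1"
    using conf_p_square[of q r] by algebra
  finally show ?thesis using conf_rho_pos[of q r t] by (simp add: field_simps)
qed

text \<open>The square root of a positive definite matrix; the value of \<open>m\<close> solves
  \<open>P = 2 m^2 - 1\<close>.\<close>

lemma conf_parameters:
  obtains q r where "Q = 2 * conf_p q r * q" "R = 2 * conf_p q r * r"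
proof -
  define P where "P = conf_p Q R"
  have P: "P\<^sup>2 = 1 + Q\<^sup>2 + R\<^sup>2" "P > 0" by (simp_all add: P_def conf_p_square conf_p_pos)
  define m where "m = sqrt ((P + 1) / 2)"
  have m: "m\<^sup>2 = (P + 1) / 2" "m > 0" using P by (simp_all add: m_def)
  define q r where "q = Q / (2 * m)" and "r = R / (2 * m)"
  have "4 * m\<^sup>2 * (1 + q\<^sup>2 + r\<^sup>2) = 4 * m\<^sup>2 + (Q\<^sup>2 + R\<^sup>2)"
    using m by (simp add: q_def r_def field_simps power2_eq_square)
  also have "\<dots> = 4 * m\<^sup>2 * m\<^sup>2" using m(1) P(1) by algebra
  finally have "1 + q\<^sup>2 + r\<^sup>2 = m\<^sup>2" using m(2) by simp
  then have "conf_p q r = m" unfolding conf_p_def using m(2) by simp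
  moreover have "Q = 2 * m * q" "R = 2 * m * r" using m(2) by (simp_all add: q_def r_def)
  ultimately show ?thesis using that[of q r] by blast
qed

text \<open>If \<open>(Q, R)\<close> is a critical point of \<open>\<integral> u W\<^sup>-\<^sup>5\<^sup>/\<^sup>2\<close>, then the second Fourier modes of the
  pullback of \<open>u\<close> vanish.\<close>

lemma energy3_critical:
  assumes u: "circle_C2 u u1 u2"
    and cQ: "(\<integral>x. u x * weight Q R x powr (-7/2) * (Q / conf_p Q R - cos (2 * x)) \<partial>circ) = 0"
    and cR: "(\<integral>x. u x * weight Q R x powr (-7/2) * (R / conf_p Q R - sin (2 * x)) \<partial>circ) = 0"
  shows "energy3 u u1 u2 \<ge> 9 / (2 * pi) * (\<integral>x. u x * weight Q R x powr (-5/2) \<partial>circ)\<^sup>2"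
proof -
  obtain q r where Q: "Q = 2 * conf_p q r * q" and R: "R = 2 * conf_p q r * r"
    by (rule conf_parameters)
  define P where "P = 1 + 2 * (q\<^sup>2 + r\<^sup>2)"
  have P: "conf_p Q R = P" "P > 0" unfolding Q R conf_p_double P_def by (simp_all add: add_pos_nonneg)
  define \<rho> \<sigma> \<theta> where "\<rho> = conf_rho q r" and "\<sigma> = conf_sigma q r" and "\<theta> = conf_theta q r"
  note rho = conf_rho_pos[of q r, folded \<rho>_def] conf_rho_deriv[of q r, folded \<rho>_def \<sigma>_def]
    conf_sigma_deriv[of q r, folded \<rho>_def \<sigma>_def] conf_theta_deriv[of q r, folded \<rho>_def \<theta>_def]
    conf_periodic(3-5)[of q r, folded \<rho>_def \<sigma>_def \<theta>_def]
  note pull = conformal_pullback[of \<rho> \<sigma> \<theta> u u1 u2, OF rho u]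
  define v where "v t = \<rho> t ^ 3 * u (\<theta> t)" for t
  define v1 where "v1 t = 3 * (\<rho> t)\<^sup>2 * \<sigma> t * u (\<theta> t) + \<rho> t * u1 (\<theta> t)" for t
  define v2 where "v2 t = (6 * \<rho> t * (\<sigma> t)\<^sup>2 + 3 / \<rho> t - 3 * \<rho> t ^ 3) * u (\<theta> t) + 4 * \<sigma> t * u1 (\<theta> t) + u2 (\<theta> t) / \<rho> t" for t
  have v: "circle_C2 v v1 v2" "energy3 v v1 v2 = energy3 u u1 u2"
    using pull unfolding v_def[abs_def] v1_def[abs_def] v2_def[abs_def] by auto
  have W: "weight Q R (\<theta> t) = 1 / (\<rho> t)\<^sup>2" for t
    unfolding Q R \<theta>_def \<rho>_def by (rule weight_conf_theta)
  have powr1: "(1 / (\<rho> t)\<^sup>2) powr (- (real n / 2)) = \<rho> t ^ n" for t n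
  proof -
    have "(1 / (\<rho> t)\<^sup>2) = \<rho> t powr (-2)"
      using rho(1)[of t] by (simp add: powr_minus powr_numeral divide_inverse)
    then show ?thesis using rho(1)[of t] by (simp add: powr_powr powr_realpow)
  qed
  have W5: "weight Q R (\<theta> t) powr (-5/2) = \<rho> t ^ 5" and W7: "weight Q R (\<theta> t) powr (-7/2) = \<rho> t ^ 7" for t
    using powr1[of t 5] powr1[of t 7] by (simp_all add: W)
  have cu: "continuous_on UNIV u" using circle_C2_continuous[OF u] by simp
  have pu: "u (x + 2 * pi) = u x" for x using u by (simp add: circle_C2_def)
  have cW: "continuous_on UNIV (\<lambda>x. weight Q R x powr s)" for s
    using weight_pos[of Q R] unfolding weight_def by (intro continuous_intros) (auto simp: less_imp_neq[symmetric])
  have c\<rho>: "continuous_on UNIV \<rho>"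
    using rho(2) by (meson DERIV_isCont continuous_at_imp_continuous_on)
  have cw: "continuous_on UNIV (\<lambda>t. 1 / (\<rho> t)\<^sup>2)"
    using rho(1) by (intro continuous_intros c\<rho>) (auto simp: less_imp_neq[symmetric])
  have cv: "continuous_on UNIV v" using circle_C2_continuous[OF v(1)] by simp
  have th0: "\<theta> (2 * pi) = \<theta> 0 + 2 * pi" using rho(7)[of 0] by simp
  have sub: "(\<integral>t. f (\<theta> t) * (1 / (\<rho> t)\<^sup>2) \<partial>circ) = (\<integral>x. f x \<partial>circ)"
    if "continuous_on UNIV f" "\<And>x. f (x + 2 * pi) = f x" for f
    using circ_integral_substitution[of f \<theta> "\<lambda>t. 1 / (\<rho> t)\<^sup>2"] that rho(4) th0 cw by blast
  have nz: "\<rho> t \<noteq> 0" for t using rho(1)[of t] by simp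
  have F: "(\<integral>x. u x * weight Q R x powr (-5/2) \<partial>circ) = (\<integral>t. v t \<partial>circ)"
  proof -
    have "(\<integral>x. u x * weight Q R x powr (-5/2) \<partial>circ) = (\<integral>t. u (\<theta> t) * weight Q R (\<theta> t) powr (-5/2) * (1 / (\<rho> t)\<^sup>2) \<partial>circ)"
      by (rule sub[of "\<lambda>x. u x * weight Q R x powr (-5/2)", symmetric])
         (intro continuous_intros cu cW, simp only: pu conf_periodic)
    also have "\<dots> = (\<integral>t. v t \<partial>circ)"
      unfolding W5 v_def using nz by (intro Bochner_Integration.integral_cong) (auto simp: eval_nat_numeral)
    finally show ?thesis .
  qed
  define X Y where "X = (\<integral>t. v t * cos (2 * t) \<partial>circ)" and "Y = (\<integral>t. v t * sin (2 * t) \<partial>circ)"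
  have iX: "integrable circ (\<lambda>t. v t * cos (2 * t))" "integrable circ (\<lambda>t. v t * sin (2 * t))"
    by (intro integrable_circ_continuous_UNIV continuous_intros cv)+
  have rho2: "(\<rho> t)\<^sup>2 = P + Q * cos (2 * t) + R * sin (2 * t)" for t
    unfolding \<rho>_def conf_rho_square' conf_D_def Q R P_def using conf_p_square[of q r] by algebra
  have "(\<integral>x. u x * weight Q R x powr (-7/2) * (Q / P - cos (2 * x)) \<partial>circ) =
      (\<integral>t. u (\<theta> t) * weight Q R (\<theta> t) powr (-7/2) * (Q / P - cos (2 * \<theta> t)) * (1 / (\<rho> t)\<^sup>2) \<partial>circ)"
    by (rule sub[of "\<lambda>x. u x * weight Q R x powr (-7/2) * (Q / P - cos (2 * x))", symmetric])
        (intro continuous_intros cu cW, simp only: pu conf_periodic double_periodic)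
  also have "\<dots> = (\<integral>t. - (1 + 2 * q\<^sup>2 - Q\<^sup>2 / P) * (v t * cos (2 * t)) - (2 * q * r - Q * R / P) * (v t * sin (2 * t)) \<partial>circ)"
  proof (intro Bochner_Integration.integral_cong refl)
    fix t
    have "u (\<theta> t) * weight Q R (\<theta> t) powr (-7/2) * (Q / P - cos (2 * \<theta> t)) * (1 / (\<rho> t)\<^sup>2) =
       v t * (Q / P * (\<rho> t)\<^sup>2 - (\<rho> t)\<^sup>2 * cos (2 * \<theta> t))"
      unfolding W7 v_def using nz[of t] by (simp add: field_simps eval_nat_numeral)
    \<comment> \<open>The constant terms \<open>Q / P * P\<close> and \<open>Q\<close> cancel, so
      the mean of \<open>v\<close> drops out and only its second modes remain.\<close>
    also have "\<dots> = v t * (Q / P * (P + Q * cos (2 * t) + R * sin (2 * t)) - (Q + (1 + 2 * q\<^sup>2) * cos (2 * t) + 2 * q * r * sin (2 * t)))"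
      using conf_theta_double(1)[of q r t, folded \<rho>_def \<theta>_def Q] by (simp only: rho2)
    also have "\<dots> = - (1 + 2 * q\<^sup>2 - Q\<^sup>2 / P) * (v t * cos (2 * t)) - (2 * q * r - Q * R / P) * (v t * sin (2 * t))"
      using P(2) by (simp add: field_simps power2_eq_square)
    finally show "u (\<theta> t) * weight Q R (\<theta> t) powr (-7/2) * (Q / P - cos (2 * \<theta> t)) * (1 / (\<rho> t)\<^sup>2) =
      - (1 + 2 * q\<^sup>2 - Q\<^sup>2 / P) * (v t * cos (2 * t)) - (2 * q * r - Q * R / P) * (v t * sin (2 * t))" .
  qed
  also have "\<dots> = - (1 + 2 * q\<^sup>2 - Q\<^sup>2 / P) * X - (2 * q * r - Q * R / P) * Y"
    unfolding X_def Y_def using iX by simp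
  finally have e1: "(1 + 2 * q\<^sup>2 - Q\<^sup>2 / P) * X + (2 * q * r - Q * R / P) * Y = 0"
    using cQ unfolding P(1) by linarith
  have "(\<integral>x. u x * weight Q R x powr (-7/2) * (R / P - sin (2 * x)) \<partial>circ) =
      (\<integral>t. u (\<theta> t) * weight Q R (\<theta> t) powr (-7/2) * (R / P - sin (2 * \<theta> t)) * (1 / (\<rho> t)\<^sup>2) \<partial>circ)"
    by (rule sub[of "\<lambda>x. u x * weight Q R x powr (-7/2) * (R / P - sin (2 * x))", symmetric])
        (intro continuous_intros cu cW, simp only: pu conf_periodic double_periodic)
  also have "\<dots> = (\<integral>t. - (2 * q * r - Q * R / P) * (v t * cos (2 * t)) - (1 + 2 * r\<^sup>2 - R\<^sup>2 / P) * (v t * sin (2 * t)) \<partial>circ)"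
  proof (intro Bochner_Integration.integral_cong refl)
    fix t
    have "u (\<theta> t) * weight Q R (\<theta> t) powr (-7/2) * (R / P - sin (2 * \<theta> t)) * (1 / (\<rho> t)\<^sup>2) =
       v t * (R / P * (\<rho> t)\<^sup>2 - (\<rho> t)\<^sup>2 * sin (2 * \<theta> t))"
      unfolding W7 v_def using nz[of t] by (simp add: field_simps eval_nat_numeral)
    also have "\<dots> = v t * (R / P * (P + Q * cos (2 * t) + R * sin (2 * t)) - (R + 2 * q * r * cos (2 * t) + (1 + 2 * r\<^sup>2) * sin (2 * t)))"
      using conf_theta_double(2)[of q r t, folded \<rho>_def \<theta>_def R] by (simp only: rho2)
    also have "\<dots> = - (2 * q * r - Q * R / P) * (v t * cos (2 * t)) - (1 + 2 * r\<^sup>2 - R\<^sup>2 / P) * (v t * sin (2 * t))"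
      using P(2) by (simp add: field_simps power2_eq_square)
    finally show "u (\<theta> t) * weight Q R (\<theta> t) powr (-7/2) * (R / P - sin (2 * \<theta> t)) * (1 / (\<rho> t)\<^sup>2) =
      - (2 * q * r - Q * R / P) * (v t * cos (2 * t)) - (1 + 2 * r\<^sup>2 - R\<^sup>2 / P) * (v t * sin (2 * t))" .
  qed
  also have "\<dots> = - (2 * q * r - Q * R / P) * X - (1 + 2 * r\<^sup>2 - R\<^sup>2 / P) * Y"
    unfolding X_def Y_def using iX by simp
  finally have e2: "(2 * q * r - Q * R / P) * X + (1 + 2 * r\<^sup>2 - R\<^sup>2 / P) * Y = 0"
    using cR unfolding P(1) by linarith
  have p2: "Q\<^sup>2 = 2 * (P + 1) * q\<^sup>2" "Q * R = 2 * (P + 1) * (q * r)" "R\<^sup>2 = 2 * (P + 1) * r\<^sup>2"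
    using conf_p_square[of q r] unfolding Q R P_def by algebra+
  \<comment> \<open>Multiplied by \<open>P\<close>, the linear system for \<open>X\<close>,
    \<open>Y\<close> is \<open>P\<close> times the identity minus twice the rank-one matrix built
    from \<open>(q, r)\<close>. The only nonzero eigenvalue of the subtracted part is
    \<open>2 (q^2 + r^2) = P - 1\<close>, which differs from \<open>P\<close>, so the system is
    nonsingular.\<close>
  define Z where "Z = q * X + r * Y"
  have e1': "P * X = 2 * q * Z"
  proof -
    have "P * ((1 + 2 * q\<^sup>2 - Q\<^sup>2 / P) * X + (2 * q * r - Q * R / P) * Y) = P * X - 2 * q * Z"
      using P(2) unfolding p2 Z_def by (simp add: field_simps power2_eq_square)
    then show ?thesis using e1 by simp
  qed
  have e2': "P * Y = 2 * r * Z"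
  proof -
    have "P * ((2 * q * r - Q * R / P) * X + (1 + 2 * r\<^sup>2 - R\<^sup>2 / P) * Y) = P * Y - 2 * r * Z"
      using P(2) unfolding p2 Z_def by (simp add: field_simps power2_eq_square)
    then show ?thesis using e2 by simp
  qed
  have "P * Z = (P - 1) * Z" using e1' e2' unfolding Z_def P_def by algebra
  then have "Z = 0" by (simp add: algebra_simps)
  then have XY: "X = 0" "Y = 0" using e1' e2' P(2) by simp_all
  have "energy3 v v1 v2 \<ge> 18 * pi * (fourier_cos v 0)\<^sup>2"
    by (rule energy3_lower_bound[OF circle_C2_imp_H2[OF v(1)]])
       (use XY in \<open>simp_all add: fourier_cos_def fourier_sin_def X_def Y_def\<close>)
  also have "18 * pi * (fourier_cos v 0)\<^sup>2 = 9 / (2 * pi) * (\<integral>t. v t \<partial>circ)\<^sup>2"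
    by (simp add: fourier_cos_def fourier_wt_def field_simps power2_eq_square)
  finally show ?thesis unfolding F v(2) .
qed

section \<open>The minimising transformation\<close>

text \<open>At \<open>\<theta> t\<close> the weight is \<open>1 / \<rho>^2\<close>, so its power
  \<open>-5/2\<close> is \<open>\<rho>^5\<close>; the Jacobian \<open>1 / \<rho>^2\<close> leaves
  the factor \<open>\<rho>^3\<close> of the pullback.\<close>

definition weighted_mean :: "(real \<Rightarrow> real) \<Rightarrow> real \<Rightarrow> real \<Rightarrow> real" where
  "weighted_mean u Q R = (\<integral>x. u x * weight Q R x powr (-5/2) \<partial>circ)"

lemma continuous_weight_powr: "continuous_on S (\<lambda>x. weight Q R x powr s)"
  using weight_pos[of Q R] unfolding weight_def
  by (intro continuous_intros) (auto simp: less_imp_neq[symmetric])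

lemma continuous_weight_powr_param:
  fixes f g h :: "'a::t2_space \<Rightarrow> real"
  assumes "continuous_on S f" "continuous_on S g" "continuous_on S h"
  shows "continuous_on S (\<lambda>z. weight (f z) (g z) (h z) powr s)"
proof -
  have "continuous_on S (\<lambda>z. weight (f z) (g z) (h z))"
    unfolding weight_def conf_p_def by (intro continuous_intros assms)
  then show ?thesis
    using weight_pos by (intro continuous_intros) (auto simp: less_imp_neq[symmetric])
qed

lemma weighted_mean_eq_integral:
  assumes "continuous_on UNIV u"
  shows "weighted_mean u Q R = integral (cbox 0 (2 * pi)) (\<lambda>x. u x * weight Q R x powr (-5/2))"
  unfolding weighted_mean_def box_real
  by (intro circ_integral_eq_integral continuous_intros continuous_weight_powr continuous_on_subset[OF assms]) auto

lemma continuous_weighted_mean: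
  assumes u: "continuous_on UNIV u"
  shows "continuous_on UNIV (\<lambda>z. weighted_mean u (fst z) (snd z))"
proof -
  have "continuous_on (UNIV \<times> cbox 0 (2 * pi))
      (\<lambda>(z, x). u x * weight (fst z) (snd z) x powr (-5/2))"
    unfolding case_prod_unfold
    by (intro continuous_intros continuous_weight_powr_param continuous_on_compose2[OF u]) auto
  from integral_continuous_on_param[OF this] show ?thesis
    by (simp only: weighted_mean_eq_integral[OF u])
qed

lemma polar_coordinates:
  fixes x y :: real
  shows "\<exists>\<phi>. 0 \<le> \<phi> \<and> \<phi> < 2 * pi \<and> x = sqrt (x\<^sup>2 + y\<^sup>2) * cos \<phi> \<and> y = sqrt (x\<^sup>2 + y\<^sup>2) * sin \<phi>"
proof (cases "sqrt (x\<^sup>2 + y\<^sup>2) = 0")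
  case True
  then have "x = 0" "y = 0" by (auto simp: sum_power2_eq_zero_iff)
  then show ?thesis by (intro exI[of _ 0]) simp
next
  case False
  define K where "K = sqrt (x\<^sup>2 + y\<^sup>2)"
  have K: "K \<noteq> 0" "K\<^sup>2 = x\<^sup>2 + y\<^sup>2" using False by (simp_all add: K_def)
  then have "(x / K)\<^sup>2 + (y / K)\<^sup>2 = 1"
    by (simp add: power_divide add_divide_distrib[symmetric]) (use K in auto)
  then obtain \<phi> where "0 \<le> \<phi>" "\<phi> < 2 * pi" "x / K = cos \<phi>" "y / K = sin \<phi>"
    using sincos_total_2pi by metis
  then show ?thesis using K(1) unfolding K_def[symmetric]
    by (intro exI[of _ \<phi>]) (simp add: field_simps)
qed

text \<open>The weight \<open>W\<close> drops to at most \<open>3/P\<close> on an interval of length \<open>1/P\<close>.\<close>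

lemma weighted_mean_coercive:
  assumes u: "continuous_on UNIV u" and m: "m > 0" "\<And>x. x \<in> {0..2*pi} \<Longrightarrow> u x \<ge> m"
    and P: "conf_p Q R \<ge> 3"
  shows "weighted_mean u Q R \<ge> m * conf_p Q R / 9"
proof -
  define P where "P = conf_p Q R"
  define K where "K = sqrt (Q\<^sup>2 + R\<^sup>2)"
  have P3: "P \<ge> 3" using P by (simp add: P_def)
  have P2: "P\<^sup>2 = 1 + K\<^sup>2" unfolding P_def K_def by (simp add: conf_p_square)
  have K0: "K \<ge> 0" by (simp add: K_def)
  have KP: "K \<le> P" using P2 P3 by (intro power2_le_imp_le[of K P]) auto
  obtain \<phi> where \<phi>: "0 \<le> \<phi>" "\<phi> < 2 * pi" "Q = K * cos \<phi>" "R = K * sin \<phi>"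
    using polar_coordinates[of Q R] unfolding K_def by auto
  \<comment> \<open>\<open>P - K = 1 / (P + K)\<close> is the minimum of the weight, attained at
    \<open>x = \<phi> / 2\<close>.\<close>
  have PK: "P - K \<le> 1 / P"
  proof -
    have "(P - K) * P \<le> (P - K) * (P + K)" using KP K0 by (intro mult_left_mono) auto
    also have "\<dots> = 1" using P2 by (simp add: algebra_simps power2_eq_square)
    finally show ?thesis using P3 by (simp add: field_simps)
  qed
  have W: "weight Q R x powr (-5/2) \<ge> (P / 3)\<^sup>2" if x: "x \<in> {\<phi>/2..\<phi>/2 + 1/P}" for x
  proof -
    define t where "t = x - \<phi> / 2"
    have t: "0 \<le> t" "t \<le> 1 / P" using x by (auto simp: t_def)
    have "(sin t)\<^sup>2 \<le> t\<^sup>2"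
      using abs_sin_x_le_abs_x[of t] by (simp add: abs_le_square_iff)
    also have "t\<^sup>2 \<le> (1 / P)\<^sup>2" using t by (intro power_mono) auto
    finally have s: "(sin t)\<^sup>2 \<le> (1 / P)\<^sup>2" .
    have "2 * x = 2 * t + \<phi>" by (simp add: t_def)
    then have "weight Q R x = P - K * (cos \<phi> * cos (2 * t + \<phi>) + sin \<phi> * sin (2 * t + \<phi>))"
      unfolding weight_def P_def[symmetric] by (simp add: \<phi>(3,4) algebra_simps)
    also have "cos \<phi> * cos (2 * t + \<phi>) + sin \<phi> * sin (2 * t + \<phi>) = cos (2 * t)"
      using cos_diff[of "2 * t + \<phi>" \<phi>] by (simp add: mult.commute)
    also have "P - K * cos (2 * t) = (P - K) + K * (2 * (sin t)\<^sup>2)"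
      by (simp only: cos_double_sin, simp add: algebra_simps)
    also have "\<dots> \<le> 1 / P + P * (2 * (1 / P)\<^sup>2)"
      using s KP K0 PK by (intro add_mono mult_mono) auto
    also have "\<dots> = 3 / P" using P3 by (simp add: field_simps power2_eq_square)
    finally have "weight Q R x \<le> 3 / P" .
    then have "(3 / P) powr (-5/2) \<le> weight Q R x powr (-5/2)"
      using weight_pos[of Q R x] by (intro powr_mono2') auto
    \<comment> \<open>Lowering the exponent from \<open>5/2\<close> to 2 is allowed because
      \<open>P / 3\<close> is at least 1; this still beats the interval length
      \<open>1 / P\<close>.\<close>
    moreover have "(P / 3)\<^sup>2 \<le> (3 / P) powr (-5/2)"
    proof -
      have "(P / 3)\<^sup>2 = (P / 3) powr 2" using P3 by (simp add: powr_numeral)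
      also have "\<dots> \<le> (P / 3) powr (5/2)" using P3 by (intro powr_mono) auto
      also have "\<dots> = (3 / P) powr (-5/2)"
        using P3 by (simp add: powr_minus powr_divide)
      finally show ?thesis .
    qed
    ultimately show ?thesis by linarith
  qed
  let ?I = "{\<phi>/2..\<phi>/2 + 1/P}"
  \<comment> \<open>Since \<open>\<phi> / 2 < pi\<close>, the interval starts in the first half of
    the period; being no longer than \<open>pi\<close>, it does not wrap round.\<close>
  have "1 / P \<le> 1" using P3 by simp
  then have "1 / P \<le> pi" using pi_ge_two by linarith
  then have sub: "?I \<subseteq> {0..2*pi}" using \<phi>(1,2) by auto
  have "m * P / 9 = m * (P / 3)\<^sup>2 * (1 / P)"
    using P3 by (simp add: field_simps power2_eq_square)
  also have "\<dots> = integral ?I (\<lambda>x. m * (P / 3)\<^sup>2)"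
    using P3 by simp
  also have "\<dots> \<le> integral ?I (\<lambda>x. u x * weight Q R x powr (-5/2))"
  proof (rule integral_le)
    show "(\<lambda>x. u x * weight Q R x powr (-5/2)) integrable_on ?I"
      by (intro integrable_continuous_interval continuous_intros continuous_weight_powr continuous_on_subset[OF u]) auto
    show "m * (P / 3)\<^sup>2 \<le> u x * weight Q R x powr (-5/2)" if "x \<in> ?I" for x
    proof -
      have "x \<in> {0..2*pi}" using sub that by blast
      from m(2)[OF this] W[OF that] m(1)
      show "m * (P / 3)\<^sup>2 \<le> u x * weight Q R x powr (-5/2)" by (intro mult_mono) auto
    qed
  qed auto
  also have "\<dots> \<le> integral {0..2*pi} (\<lambda>x. u x * weight Q R x powr (-5/2))"
  proof (rule integral_subset_le[OF sub])
    show "(\<lambda>x. u x * weight Q R x powr (-5/2)) integrable_on ?I"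
      "(\<lambda>x. u x * weight Q R x powr (-5/2)) integrable_on {0..2*pi}"
      by (intro integrable_continuous_interval continuous_intros continuous_weight_powr continuous_on_subset[OF u], simp)+
    show "\<forall>x\<in>{0..2*pi}. 0 \<le> u x * weight Q R x powr (-5/2)"
    proof
      fix x :: real assume "x \<in> {0..2*pi}"
      then show "0 \<le> u x * weight Q R x powr (-5/2)"
        using m(1) m(2)[of x] by (intro mult_nonneg_nonneg) auto
    qed
  qed
  also have "\<dots> = weighted_mean u Q R"
    by (simp add: weighted_mean_eq_integral[OF u])
  finally show ?thesis by (simp add: P_def)
qed

lemma continuous_pos_bound:
  fixes u :: "real \<Rightarrow> real"
  assumes "continuous_on UNIV u" "\<And>x. x \<in> {0..2*pi} \<Longrightarrow> u x > 0"
  obtains m where "m > 0" "\<And>x. x \<in> {0..2*pi} \<Longrightarrow> u x \<ge> m"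
proof -
  obtain x0 where "x0 \<in> {0..2*pi}" "\<And>x. x \<in> {0..2*pi} \<Longrightarrow> u x0 \<le> u x"
    using continuous_attains_inf[of "{0..2*pi}" u] continuous_on_subset[OF assms(1)] by auto
  then show ?thesis using that[of "u x0"] assms(2) by blast
qed

lemma weighted_mean_attains_min:
  assumes u: "continuous_on UNIV u" and pos: "\<And>x. x \<in> {0..2*pi} \<Longrightarrow> u x > 0"
  shows "\<exists>Q R. \<forall>Q' R'. weighted_mean u Q R \<le> weighted_mean u Q' R'"
proof -
  obtain m where m: "m > 0" "\<And>x. x \<in> {0..2*pi} \<Longrightarrow> u x \<ge> m"
    using continuous_pos_bound[OF u pos] by blast
  define B where "B = weighted_mean u 0 0"
  \<comment> \<open>The value 3 is required by the coercivity estimate; \<open>9 * B / m\<close>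
    makes its bound at least \<open>B\<close>, the value at the origin, outside the ball of radius
    \<open>C\<close>.\<close>
  define C where "C = max 3 (9 * B / m)"
  have C: "C \<ge> 3" "C \<ge> 9 * B / m" by (simp_all add: C_def)
  have "\<exists>z\<in>cball (0::real\<times>real) C. \<forall>y\<in>cball 0 C.
      weighted_mean u (fst z) (snd z) \<le> weighted_mean u (fst y) (snd y)"
    using C(1) by (intro continuous_attains_inf continuous_on_subset[OF continuous_weighted_mean[OF u]]) auto
  then obtain z where z: "z \<in> cball (0::real\<times>real) C"
    "\<And>y. y \<in> cball 0 C \<Longrightarrow> weighted_mean u (fst z) (snd z) \<le> weighted_mean u (fst y) (snd y)"
    by blast
  have z0: "weighted_mean u (fst z) (snd z) \<le> B"
    using z(2)[of "0"] C(1) by (simp add: B_def)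
  have "weighted_mean u (fst z) (snd z) \<le> weighted_mean u Q' R'" for Q' R'
  proof (cases "(Q', R') \<in> cball (0::real\<times>real) C")
    case True
    then show ?thesis using z(2)[of "(Q', R')"] by simp
  next
    case False
    then have "C < sqrt (Q'\<^sup>2 + R'\<^sup>2)" by (simp add: norm_Pair)
    also have "\<dots> \<le> conf_p Q' R'" unfolding conf_p_def by simp
    finally have P: "C < conf_p Q' R'" .
    have "B \<le> m * C / 9" using C(2) m(1) by (simp add: field_simps)
    also have "\<dots> \<le> m * conf_p Q' R' / 9" using P m(1) by simp
    also have "\<dots> \<le> weighted_mean u Q' R'"
      using P C(1) by (intro weighted_mean_coercive[OF u m]) auto
    finally show ?thesis using z0 by simp
  qed
  then show ?thesis by blast
qed

section \<open>First-order conditions at the minimum\<close>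

lemma conf_p_deriv:
  "((\<lambda>Q. conf_p Q R) has_real_derivative Q / conf_p Q R) (at Q)"
  "((\<lambda>R. conf_p Q R) has_real_derivative R / conf_p Q R) (at R)"
proof -
  have pos: "1 + Q\<^sup>2 + R\<^sup>2 > 0" by (simp add: add_pos_nonneg)
  have d: "((\<lambda>Q. 1 + Q\<^sup>2 + R\<^sup>2) has_real_derivative 2 * Q) (at Q)"
    "((\<lambda>R. 1 + Q\<^sup>2 + R\<^sup>2) has_real_derivative 2 * R) (at R)"
    by (auto intro!: derivative_eq_intros)
  note s = DERIV_real_sqrt[OF pos]
  show "((\<lambda>Q. conf_p Q R) has_real_derivative Q / conf_p Q R) (at Q)"
    unfolding conf_p_def
    by (rule DERIV_cong[OF DERIV_chain2[where g = "\<lambda>Q. 1 + Q\<^sup>2 + R\<^sup>2" and f = sqrt, OF s d(1)]])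
       (simp only: divide_inverse, simp)
  show "((\<lambda>R. conf_p Q R) has_real_derivative R / conf_p Q R) (at R)"
    unfolding conf_p_def
    by (rule DERIV_cong[OF DERIV_chain2[where g = "\<lambda>R. 1 + Q\<^sup>2 + R\<^sup>2" and f = sqrt, OF s d(2)]])
       (simp only: divide_inverse, simp)
qed

text \<open>Stated along a curve \<open>(q s, r s)\<close> in the parameter plane, so that both
  partial derivatives are instances.\<close>

lemma integral_weight_derivative:
  fixes q r :: "real \<Rightarrow> real"
  assumes u: "continuous_on UNIV u"
    and cq: "continuous_on UNIV q" and cr: "continuous_on UNIV r"
    and d: "\<And>s x. ((\<lambda>s. weight (q s) (r s) x) has_real_derivative g s x) (at s)"
    and cg: "continuous_on UNIV (\<lambda>z. g (fst z) (snd z))"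
  shows "((\<lambda>s. weighted_mean u (q s) (r s)) has_real_derivative
     -5/2 * (\<integral>x. u x * weight (q s) (r s) x powr (-7/2) * g s x \<partial>circ)) (at s)"
proof -
  let ?f = "\<lambda>s x. u x * weight (q s) (r s) x powr (-5/2)"
  let ?f' = "\<lambda>s x. u x * (weight (q s) (r s) x powr (-5/2 - 1) * (-5/2) * g s x)"
  have "((\<lambda>s. integral (cbox 0 (2*pi)) (?f s)) has_real_derivative integral (cbox 0 (2*pi)) (?f' s)) (at s within UNIV)"
  proof (rule leibniz_rule_field_derivative)
    fix s x
    have "((\<lambda>s. weight (q s) (r s) x powr (-5/2)) has_real_derivative
       weight (q s) (r s) x powr (-5/2 - 1) * (-5/2) * g s x) (at s)"
    proof -
      have "((\<lambda>w. w powr (-5/2)) has_real_derivative -5/2 * weight (q s) (r s) x powr (-5/2 - 1)) (at (weight (q s) (r s) x))"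
        by (rule has_real_derivative_powr[OF weight_pos])
      from DERIV_chain2[OF this d] show ?thesis by (simp only: mult_ac)
    qed
    from DERIV_cmult[OF this, of "u x"]
    show "((\<lambda>s. ?f s x) has_real_derivative ?f' s x) (at s within UNIV)"
      by simp
  next
    show "?f s integrable_on cbox 0 (2*pi)" for s
      by (intro integrable_continuous continuous_intros continuous_weight_powr continuous_on_subset[OF u]) auto
    show "continuous_on (UNIV \<times> cbox 0 (2*pi)) (\<lambda>(s, x). ?f' s x)"
      unfolding case_prod_unfold
      by (intro continuous_intros continuous_weight_powr_param continuous_on_compose2[OF u]
          continuous_on_compose2[OF cq] continuous_on_compose2[OF cr] continuous_on_subset[OF cg]) auto
  qed auto
  moreover have "integral (cbox 0 (2*pi)) (?f' s) =
      -5/2 * (\<integral>x. u x * weight (q s) (r s) x powr (-7/2) * g s x \<partial>circ)"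
  proof -
    have cgs: "continuous_on UNIV (g s)"
      by (rule continuous_on_compose2[OF cg, of UNIV "\<lambda>x. (s, x)", simplified]) (intro continuous_intros)
    have "(\<integral>x. ?f' s x \<partial>circ) = integral (cbox 0 (2*pi)) (?f' s)"
      unfolding box_real
      by (intro circ_integral_eq_integral continuous_intros continuous_weight_powr continuous_on_subset[OF u]
           continuous_on_subset[OF cgs]) auto
    also have "(\<integral>x. ?f' s x \<partial>circ) = (\<integral>x. -5/2 * (u x * weight (q s) (r s) x powr (-7/2) * g s x) \<partial>circ)"
      by (intro Bochner_Integration.integral_cong) auto
    finally show ?thesis by simp
  qed
  ultimately show ?thesis by (simp add: weighted_mean_eq_integral[OF u])
qed

lemma weighted_mean_critical:
  assumes u: "continuous_on UNIV u" and min: "\<And>Q' R'. weighted_mean u Q R \<le> weighted_mean u Q' R'"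
  shows "(\<integral>x. u x * weight Q R x powr (-7/2) * (Q / conf_p Q R - cos (2 * x)) \<partial>circ) = 0"
    and "(\<integral>x. u x * weight Q R x powr (-7/2) * (R / conf_p Q R - sin (2 * x)) \<partial>circ) = 0"
proof -
  have cp: "continuous_on S (\<lambda>z. conf_p (f z) (h z))" if "continuous_on S f" "continuous_on S h"
    for f h :: "real \<times> real \<Rightarrow> real" and S
    unfolding conf_p_def by (intro continuous_intros that)
  have nz: "conf_p Q R \<noteq> 0" for Q R using conf_p_pos[of Q R] by simp
  have "((\<lambda>s. weighted_mean u s R) has_real_derivative
     -5/2 * (\<integral>x. u x * weight Q R x powr (-7/2) * (Q / conf_p Q R - cos (2 * x)) \<partial>circ)) (at Q)"
  proof (rule integral_weight_derivative[OF u, of "\<lambda>s. s" "\<lambda>s. R" "\<lambda>Q x. Q / conf_p Q R - cos (2 * x)"])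
    show "continuous_on UNIV (\<lambda>z. fst z / conf_p (fst z) R - cos (2 * snd z))"
      by (intro continuous_intros cp) (auto simp: nz)
    show "((\<lambda>s. weight s R x) has_real_derivative s / conf_p s R - cos (2 * x)) (at s)" for s x
      unfolding weight_def by (auto intro!: derivative_eq_intros conf_p_deriv)
  qed (auto intro!: continuous_intros)
  from DERIV_local_min[OF this zero_less_one] min
  show "(\<integral>x. u x * weight Q R x powr (-7/2) * (Q / conf_p Q R - cos (2 * x)) \<partial>circ) = 0" by simp
  have "((\<lambda>s. weighted_mean u Q s) has_real_derivative
     -5/2 * (\<integral>x. u x * weight Q R x powr (-7/2) * (R / conf_p Q R - sin (2 * x)) \<partial>circ)) (at R)"
  proof (rule integral_weight_derivative[OF u, of "\<lambda>s. Q" "\<lambda>s. s" "\<lambda>R x. R / conf_p Q R - sin (2 * x)"])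
    show "continuous_on UNIV (\<lambda>z. fst z / conf_p Q (fst z) - sin (2 * snd z))"
      by (intro continuous_intros cp) (auto simp: nz)
    show "((\<lambda>s. weight Q s x) has_real_derivative s / conf_p Q s - sin (2 * x)) (at s)" for s x
      unfolding weight_def by (auto intro!: derivative_eq_intros conf_p_deriv)
  qed (auto intro!: continuous_intros)
  from DERIV_local_min[OF this zero_less_one] min
  show "(\<integral>x. u x * weight Q R x powr (-7/2) * (R / conf_p Q R - sin (2 * x)) \<partial>circ) = 0" by simp
qed

lemma energy3_C2_lower_bound:
  assumes u: "circle_C2 u u1 u2" and pos: "\<And>x. x \<in> {0..2*pi} \<Longrightarrow> u x > 0"
  shows "\<exists>Q R. energy3 u u1 u2 \<ge> 9 / (2 * pi) * (weighted_mean u Q R)\<^sup>2"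
proof -
  note cu = circle_C2_continuous(1)[OF u]
  obtain Q R where "\<forall>Q' R'. weighted_mean u Q R \<le> weighted_mean u Q' R'"
    using weighted_mean_attains_min[of u] cu pos by auto
  then have min: "weighted_mean u Q R \<le> weighted_mean u Q' R'" for Q' R' by blast
  from energy3_critical[OF u weighted_mean_critical[OF cu min]] show ?thesis
    unfolding weighted_mean_def by blast
qed

section \<open>From trigonometric polynomials to weakly differentiable functions\<close>

lemma trig_sum_circle_C2:
  "circle_C2 (trig_sum a b N) (trig_sum (\<lambda>k. real k * b k) (\<lambda>k. - real k * a k) N)
     (trig_sum (\<lambda>k. - (real k)\<^sup>2 * a k) (\<lambda>k. - (real k)\<^sup>2 * b k) N)"
proof -
  have e: "(\<lambda>k. - (real k)\<^sup>2 * a k) = (\<lambda>k. real k * (- real k * a k))"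
    "(\<lambda>k. - (real k)\<^sup>2 * b k) = (\<lambda>k. - real k * (real k * b k))"
    by (simp_all add: power2_eq_square mult.assoc)
  show ?thesis unfolding circle_C2_def e
    by (intro conjI allI trig_sum_deriv continuous_trig_sum trig_sum_periodic)
qed

lemma weighted_mean_mono:
  assumes "continuous_on UNIV u" "continuous_on UNIV v" "\<And>x. x \<in> {0..2*pi} \<Longrightarrow> u x \<le> v x"
  shows "weighted_mean u Q R \<le> weighted_mean v Q R"
  unfolding weighted_mean_def
proof (rule integral_mono)
  fix x assume "x \<in> space circ"
  then have "x \<in> {0..2*pi}" by (simp add: space_restrict_space)
  then show "u x * weight Q R x powr (-5/2) \<le> v x * weight Q R x powr (-5/2)"
    by (intro mult_right_mono assms) auto
qed (intro integrable_circ_continuous_UNIV continuous_intros continuous_weight_powr assms)+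

text \<open>The minimising parameters of the partial sums vary with \<open>N\<close> and are not
  followed to a limit. Instead the partial sum is at least \<open>(1 - e) * f\<close> on the period,
  so its weighted mean at any parameters is at least \<open>(1 - e) * m\<close>. Positivity of
  \<open>f\<close> turns uniform convergence into this relative estimate.\<close>

lemma energy3_ge_weighted_mean:
  assumes f: "circle_H2 f f1 f2" and pos: "\<And>x. x \<in> {0..2*pi} \<Longrightarrow> f x > 0"
    and m: "m \<ge> 0" "\<And>Q R. m \<le> weighted_mean f Q R"
  shows "energy3 f f1 f2 \<ge> 9 / (2 * pi) * m\<^sup>2"
proof -
  have cf: "continuous_on UNIV f" using f by (simp add: circle_H2_def)
  obtain \<mu> where \<mu>: "\<mu> > 0" "\<And>x. x \<in> {0..2*pi} \<Longrightarrow> f x \<ge> \<mu>"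
    using continuous_pos_bound[OF cf pos] by blast
  define c where "c = 9 / (2 * pi) * m\<^sup>2"
  have c0: "c \<ge> 0" by (simp add: c_def)
  have approx: "c * (1 - 2 * e) \<le> energy3 f f1 f2 + e" if e: "e > 0" "e < 1" for e
  proof -
    let ?S1 = "\<lambda>N. trig_sum (\<lambda>k. real k * fourier_sin f k) (\<lambda>k. - real k * fourier_cos f k) N"
    let ?S2 = "\<lambda>N. trig_sum (\<lambda>k. - (real k)\<^sup>2 * fourier_cos f k) (\<lambda>k. - (real k)\<^sup>2 * fourier_sin f k) N"
    have "eventually (\<lambda>N. \<forall>x\<in>{0..2*pi}. dist (fourier_sum f N x) (f x) < e * \<mu>) sequentially"
      using uniform_limitD[OF H2_fourier_limits(1)[OF f], of "e * \<mu>"] e(1) \<mu>(1) by simp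
    from eventually_happens'[OF sequentially_bot eventually_conj[OF this energy3_fourier_sum_le[OF f e(1)]]]
    obtain N where N: "\<And>x. x \<in> {0..2*pi} \<Longrightarrow> \<bar>fourier_sum f N x - f x\<bar> < e * \<mu>"
      "energy3 (fourier_sum f N) (?S1 N) (?S2 N) \<le> energy3 f f1 f2 + e"
      unfolding dist_real_def by blast
    have lower: "(1 - e) * f x \<le> fourier_sum f N x" if "x \<in> {0..2*pi}" for x
    proof -
      have "e * \<mu> \<le> e * f x" using \<mu>(2)[OF that] e(1) by simp
      then show ?thesis using N(1)[OF that] by (simp add: algebra_simps abs_less_iff)
    qed
    have "fourier_sum f N x > 0" if "x \<in> {0..2*pi}" for x
      using lower[OF that] mult_pos_pos[of "1 - e" "f x"] pos[OF that] e(2) by linarith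
    then obtain Q R where QR: "9 / (2 * pi) * (weighted_mean (fourier_sum f N) Q R)\<^sup>2 \<le> energy3 (fourier_sum f N) (?S1 N) (?S2 N)"
      using energy3_C2_lower_bound[OF trig_sum_circle_C2] unfolding fourier_sum_def by blast
    have "(1 - e) * m \<le> (1 - e) * weighted_mean f Q R"
      using m(2)[of Q R] e(2) by (intro mult_left_mono) auto
    also have "\<dots> = weighted_mean (\<lambda>x. (1 - e) * f x) Q R"
      unfolding weighted_mean_def by (simp only: mult.assoc integral_mult_right_zero)
    also have "\<dots> \<le> weighted_mean (fourier_sum f N) Q R"
      by (intro weighted_mean_mono lower continuous_intros cf) (simp_all add: fourier_sum_def continuous_trig_sum)
    finally have "((1 - e) * m)\<^sup>2 \<le> (weighted_mean (fourier_sum f N) Q R)\<^sup>2"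
      using e(2) m(1) by (intro power_mono) auto
    then have "9 / (2 * pi) * ((1 - e) * m)\<^sup>2 \<le> 9 / (2 * pi) * (weighted_mean (fourier_sum f N) Q R)\<^sup>2"
      by (intro mult_left_mono) auto
    also have "9 / (2 * pi) * ((1 - e) * m)\<^sup>2 = c * (1 - e)\<^sup>2"
      by (simp add: c_def power_mult_distrib)
    finally have "c * (1 - e)\<^sup>2 \<le> energy3 f f1 f2 + e" using QR N(2) by linarith
    moreover have "c * (1 - 2 * e) \<le> c * (1 - e)\<^sup>2"
      using c0 by (intro mult_left_mono) (auto simp: power2_eq_square algebra_simps)
    ultimately show ?thesis by linarith
  qed
  have "c \<le> energy3 f f1 f2"
  proof (rule field_le_epsilon)
    fix d :: real assume d: "d > 0"
    define e where "e = min (1/2) (d / (1 + 2 * c))"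
    have e: "e > 0" "e < 1" using d c0 by (auto simp: e_def)
    have "e \<le> d / (1 + 2 * c)" by (simp add: e_def)
    then have "e * (1 + 2 * c) \<le> d" using c0 by (simp add: pos_le_divide_eq)
    then show "c \<le> energy3 f f1 f2 + d"
      using approx[OF e(1,2)] by (simp add: algebra_simps)
  qed
  then show ?thesis by (simp add: c_def)
qed

section \<open>Weak derivatives read off from Fourier coefficients\<close>

lemma deriv_trig:
  "deriv (\<lambda>x. a * cos (c * x) + b * sin (c * x)) = (\<lambda>x. (c * b) * cos (c * x) + (- c * a) * sin (c * x))"
  for a b c :: real
  by (intro ext DERIV_imp_deriv) (auto intro!: derivative_eq_intros simp: algebra_simps)

text \<open>The span of the two functions of frequency \<open>k\<close> is closed under
  differentiation, so every iterated derivative is again of this form.\<close>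

lemma smooth_circle_trig: "smooth_circle (\<lambda>x. a * cos (real k * x) + b * sin (real k * x))"
proof -
  have ex: "\<exists>a' b'. (deriv ^^ n) (\<lambda>x. a * cos (real k * x) + b * sin (real k * x)) =
      (\<lambda>x. a' * cos (real k * x) + b' * sin (real k * x))" for n
  proof (induction n)
    case (Suc n)
    then obtain a' b' where e: "(deriv ^^ n) (\<lambda>x. a * cos (real k * x) + b * sin (real k * x)) =
      (\<lambda>x. a' * cos (real k * x) + b' * sin (real k * x))" by blast
    show ?case
      by (intro exI[of _ "real k * b'"] exI[of _ "- real k * a'"]) (simp only: funpow.simps o_def e deriv_trig)
  qed auto
  have "((deriv ^^ n) (\<lambda>x. a * cos (real k * x) + b * sin (real k * x))) differentiable (at \<theta>)" for n \<theta>
  proof -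
    obtain a' b' where e: "(deriv ^^ n) (\<lambda>x. a * cos (real k * x) + b * sin (real k * x)) =
      (\<lambda>x. a' * cos (real k * x) + b' * sin (real k * x))"
      using ex by blast
    show ?thesis unfolding e real_differentiable_def by (auto intro!: exI derivative_eq_intros)
  qed
  moreover have "circle_fun (\<lambda>x. a * cos (real k * x) + b * sin (real k * x))"
    unfolding circle_fun_def
    using trig_sum_periodic[of "\<lambda>j. if j = k then a else 0" "\<lambda>j. if j = k then b else 0" "Suc k"]
    by (simp add: trig_sum_def if_distrib[of "\<lambda>y. y * _"] sum.distrib sum.delta cong: if_cong)
  ultimately show ?thesis by (simp add: smooth_circle_def)
qed

lemma has_weak_deriv_fourier:
  assumes "has_weak_deriv 1 f g"
  shows "fourier_cos g k = real k * fourier_sin f k" "fourier_sin g k = - real k * fourier_cos f k"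
proof -
  have t: "(\<integral>x. f x * deriv \<phi> x \<partial>circ) = - (\<integral>x. g x * \<phi> x \<partial>circ)" if "smooth_circle \<phi>" for \<phi>
    using assms that unfolding has_weak_deriv_def set_integral_circ by auto
  have "deriv (\<lambda>x. cos (real k * x)) = (\<lambda>x. - real k * sin (real k * x))"
    using deriv_trig[of 1 "real k" 0] by simp
  then show "fourier_cos g k = real k * fourier_sin f k"
    using t[of "\<lambda>x. cos (real k * x)"] smooth_circle_trig[of 1 k 0]
    by (simp add: fourier_cos_def fourier_sin_def mult.left_commute[of "f _"])
  have "deriv (\<lambda>x. sin (real k * x)) = (\<lambda>x. real k * cos (real k * x))"
    using deriv_trig[of 0 "real k" 1] by simp
  then show "fourier_sin g k = - real k * fourier_cos f k"
    using t[of "\<lambda>x. sin (real k * x)"] smooth_circle_trig[of 0 k 1]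
    by (simp add: fourier_cos_def fourier_sin_def mult.left_commute[of "f _"])
qed

lemma has_weak_deriv2_fourier:
  assumes "has_weak_deriv 2 f g"
  shows "fourier_cos g k = - (real k)\<^sup>2 * fourier_cos f k" "fourier_sin g k = - (real k)\<^sup>2 * fourier_sin f k"
proof -
  have t: "(\<integral>x. f x * deriv (deriv \<phi>) x \<partial>circ) = (\<integral>x. g x * \<phi> x \<partial>circ)" if "smooth_circle \<phi>" for \<phi>
    using assms that unfolding has_weak_deriv_def set_integral_circ by (auto simp: numeral_2_eq_2)
  have "deriv (deriv (\<lambda>x. cos (real k * x))) = (\<lambda>x. - (real k)\<^sup>2 * cos (real k * x))"
    using deriv_trig[of 1 "real k" 0] deriv_trig[of 0 "real k" "- real k"] by (simp add: power2_eq_square)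
  then show "fourier_cos g k = - (real k)\<^sup>2 * fourier_cos f k"
    using t[of "\<lambda>x. cos (real k * x)"] smooth_circle_trig[of 1 k 0]
    by (simp add: fourier_cos_def fourier_sin_def mult.left_commute[of "f _"])
  have "deriv (deriv (\<lambda>x. sin (real k * x))) = (\<lambda>x. - (real k)\<^sup>2 * sin (real k * x))"
    using deriv_trig[of 0 "real k" 1] deriv_trig[of "real k" "real k" 0] by (simp add: power2_eq_square)
  then show "fourier_sin g k = - (real k)\<^sup>2 * fourier_sin f k"
    using t[of "\<lambda>x. sin (real k * x)"] smooth_circle_trig[of 0 k 1]
    by (simp add: fourier_cos_def fourier_sin_def mult.left_commute[of "f _"])
qed

lemma has_weak_deriv_AE_unique:
  assumes "has_weak_deriv k f g" "has_weak_deriv k f h" "k = 1 \<or> k = 2"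
  shows "AE x in circ. g x = h x"
proof (rule fourier_coeff_unique)
  show "integrable circ g" "integrable circ h"
    using assms unfolding has_weak_deriv_def L1_circle_def set_integrable_circ by auto
qed (use assms has_weak_deriv_fourier has_weak_deriv2_fourier in auto)

text \<open>A weak derivative is only required to be in \<open>L1\<close>, so square integrability
  of the chosen \<open>weak_deriv\<close> is not immediate. It agrees almost everywhere with the
  square-integrable derivative provided by membership in \<open>H2_circle\<close>, and the energy
  may be computed with that one.\<close>

lemma H2_circle_energy:
  assumes u: "u \<in> H2_circle"
  obtains g1 g2 where "circle_H2 u g1 g2" "energy u = energy3 u g1 g2"
proof -
  have cu: "continuous_on UNIV u" and "L2_circle u" using u by (auto simp: H2_circle_def)
  obtain g1 where g1: "L2_circle g1" "has_weak_deriv 1 u g1" using u by (auto simp: H2_circle_def)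
  obtain g2 where g2: "L2_circle g2" "has_weak_deriv 2 u g2" using u by (auto simp: H2_circle_def)
  have L2: "g \<in> borel_measurable circ" "integrable circ (\<lambda>x. (g x)\<^sup>2)" if "L2_circle g" for g
    using that unfolding L2_circle_def set_integrable_circ by (auto intro: measurable_circ)
  have H2: "circle_H2 u g1 g2"
    unfolding circle_H2_def using cu L2[OF g1(1)] L2[OF g2(1)]
      has_weak_deriv_fourier[OF g1(2)] has_weak_deriv2_fourier[OF g2(2)] by blast
  have w1: "has_weak_deriv 1 u (weak_deriv 1 u)"
    unfolding weak_deriv_def by (rule someI[of "has_weak_deriv 1 u", OF g1(2)])
  have w2: "has_weak_deriv 2 u (weak_deriv 2 u)"
    unfolding weak_deriv_def by (rule someI[of "has_weak_deriv 2 u", OF g2(2)])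
  have a1: "AE x in circ. weak_deriv 1 u x = g1 x" and a2: "AE x in circ. weak_deriv 2 u x = g2 x"
    using has_weak_deriv_AE_unique[OF w1 g1(2)] has_weak_deriv_AE_unique[OF w2 g2(2)] by auto
  have mw: "weak_deriv 1 u \<in> borel_measurable circ" "weak_deriv 2 u \<in> borel_measurable circ"
    using w1 w2 unfolding has_weak_deriv_def L1_circle_def by (auto intro: measurable_circ)
  have mu: "u \<in> borel_measurable circ" "integrable circ (\<lambda>x. (u x)\<^sup>2)"
    using L2[OF \<open>L2_circle u\<close>] .
  have "energy u = (\<integral>x. (g2 x)\<^sup>2 - 10 * (g1 x)\<^sup>2 + 9 * (u x)\<^sup>2 \<partial>circ)"
    unfolding energy_def set_integral_circ
  proof (rule integral_cong_AE)
    show "AE x in circ. (weak_deriv 2 u x)\<^sup>2 - 10 * (weak_deriv 1 u x)\<^sup>2 + 9 * (u x)\<^sup>2 =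
       (g2 x)\<^sup>2 - 10 * (g1 x)\<^sup>2 + 9 * (u x)\<^sup>2"
      using a1 a2 by eventually_elim simp
  qed (use mw mu L2[OF g1(1)] L2[OF g2(1)] in measurable)
  also have "\<dots> = energy3 u g1 g2"
    unfolding energy3_def using L2[OF g1(1)] L2[OF g2(1)] mu by simp
  finally show ?thesis using that H2 by blast
qed

section \<open>The weight as a quadratic form\<close>

lemma conf_rho_weight:
  "(conf_rho q r x)\<^sup>2 = weight (2 * conf_p q r * (- q)) (2 * conf_p q r * (- r)) x"
proof -
  have "conf_p (- q) (- r) = conf_p q r" by (simp add: conf_p_def)
  then have "conf_p (2 * conf_p q r * (- q)) (2 * conf_p q r * (- r)) = 1 + 2 * (q\<^sup>2 + r\<^sup>2)"
    using conf_p_double[of "- q" "- r"] by simp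
  then show ?thesis
    unfolding weight_def conf_rho_square' conf_D_def using conf_p_square[of q r] by algebra
qed

text \<open>The weight is the quadratic form of the inverse of the matrix with parameters
  \<open>Q\<close>, \<open>R\<close>. If that matrix is \<open>A^2\<close>, the form is the squared
  length under \<open>A^(-1)\<close>, whose parameters are \<open>-q\<close> and
  \<open>-r\<close>.\<close>

lemma weight_eq_conf_rho:
  obtains q r where "\<And>x. weight Q R x = (conf_rho q r x)\<^sup>2"
proof -
  obtain q r where qr: "Q = 2 * conf_p q r * q" "R = 2 * conf_p q r * r" by (rule conf_parameters)
  have "conf_p (- q) (- r) = conf_p q r" by (simp add: conf_p_def)
  then have "weight Q R x = (conf_rho (- q) (- r) x)\<^sup>2" for x
    unfolding conf_rho_weight by (simp add: qr)
  then show ?thesis using that by blast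
qed

text \<open>\<open>1 / W\<close> is the derivative of an angle function that advances by exactly
  \<open>2 pi\<close> over one period.\<close>

lemma circ_integral_inverse_weight: "(\<integral>x. 1 / weight Q R x \<partial>circ) = 2 * pi"
proof -
  obtain q r where w: "\<And>x. weight Q R x = (conf_rho q r x)\<^sup>2" using weight_eq_conf_rho[of Q R] by blast
  have "continuous_on UNIV (\<lambda>x. weight Q R x powr (-1))" by (rule continuous_weight_powr)
  moreover have "weight Q R x powr (-1) = 1 / weight Q R x" for x
    using weight_pos[of Q R x] by (simp add: powr_minus divide_inverse)
  ultimately have c: "continuous_on UNIV (\<lambda>x. 1 / weight Q R x)" by simp
  have "(\<integral>x. 1 / weight Q R x \<partial>circ) = conf_theta q r (2 * pi) - conf_theta q r 0"
    by (rule circ_integral_FTC[OF _ c]) (unfold w, rule conf_theta_deriv)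
  then show ?thesis using conf_periodic(5)[of q r 0] by simp
qed

section \<open>The sharp inequality and its extremals\<close>

lemma circ_integral_pos:
  fixes f :: "real \<Rightarrow> real"
  assumes f: "continuous_on UNIV f" "\<And>x. f x > 0"
  shows "(\<integral>x. f x \<partial>circ) > 0"
proof -
  obtain m where m: "m > 0" "\<And>x. x \<in> {0..2*pi} \<Longrightarrow> f x \<ge> m"
    using continuous_pos_bound[OF f(1)] f(2) by blast
  \<comment> \<open>The constant \<open>m\<close> is written as a multiple of the cosine of
    frequency 0, whose integral is already known to be \<open>2 pi\<close>.\<close>
  have "(\<integral>x. m * cos (of_int 0 * x) \<partial>circ) \<le> (\<integral>x. f x \<partial>circ)"
    by (intro integral_mono integrable_circ_continuous_UNIV continuous_intros f(1))
       (use m(2) in \<open>auto simp: space_restrict_space\<close>)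
  then have "m * (2 * pi) \<le> (\<integral>x. f x \<partial>circ)"
    by (simp only: integral_mult_right_zero circ_integral_cos_int if_True refl)
  then show ?thesis using m(1) pi_gt_zero by (meson less_le_trans mult_pos_pos zero_less_numeral)
qed

text \<open>Young's inequality with weights \<open>2/5\<close> and \<open>3/5\<close>, written in
  fifth roots so that it becomes polynomial: the difference has the double factor
  \<open>(p - q)^2\<close> with a positive cofactor, which also settles equality.\<close>

lemma Young_2_3:
  fixes p q :: real
  assumes "p > 0" "q > 0"
  shows "5 * p\<^sup>2 * q ^ 3 \<le> 2 * p ^ 5 + 3 * q ^ 5"
    and "5 * p\<^sup>2 * q ^ 3 = 2 * p ^ 5 + 3 * q ^ 5 \<Longrightarrow> p = q"
proof -
  have e: "2 * p ^ 5 + 3 * q ^ 5 - 5 * p\<^sup>2 * q ^ 3 = (p - q)\<^sup>2 * (2 * p ^ 3 + 4 * p\<^sup>2 * q + 6 * p * q\<^sup>2 + 3 * q ^ 3)"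
    by algebra
  have pos: "2 * p ^ 3 + 4 * p\<^sup>2 * q + 6 * p * q\<^sup>2 + 3 * q ^ 3 > 0"
    using assms by (simp add: add_pos_pos)
  then have "(p - q)\<^sup>2 * (2 * p ^ 3 + 4 * p\<^sup>2 * q + 6 * p * q\<^sup>2 + 3 * q ^ 3) \<ge> 0"
    by (intro mult_nonneg_nonneg) auto
  then show "5 * p\<^sup>2 * q ^ 3 \<le> 2 * p ^ 5 + 3 * q ^ 5" using e by linarith
  assume "5 * p\<^sup>2 * q ^ 3 = 2 * p ^ 5 + 3 * q ^ 5"
  then have "(p - q)\<^sup>2 * (2 * p ^ 3 + 4 * p\<^sup>2 * q + 6 * p * q\<^sup>2 + 3 * q ^ 3) = 0"
    using e by linarith
  then show "p = q" using pos by simp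
qed

text \<open>Hoelder with exponents \<open>5/2\<close> and \<open>5/3\<close> for
  \<open>1 / W = (u W^(-5/2))^(2/5) (u^(-2/3))^(3/5)\<close>, whose integral is \<open>2 pi\<close>.
  It is proved by integrating Young's inequality for the normalised factors, since equality then
  becomes a pointwise statement.\<close>

lemma weighted_mean_Hoelder:
  assumes u: "continuous_on UNIV u" "\<And>x. u x > 0"
  defines "F \<equiv> \<lambda>Q R. weighted_mean u Q R" and "L \<equiv> (\<integral>x. u x powr (-2/3) \<partial>circ)"
  shows "L > 0" "F Q R > 0" "(2 * pi) ^ 5 \<le> (F Q R)\<^sup>2 * L ^ 3"
    and "(F Q R)\<^sup>2 * L ^ 3 = (2 * pi) ^ 5 \<Longrightarrow> x \<in> {0..2*pi} \<Longrightarrow>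
       u x = (F Q R / L) powr (3/5) * weight Q R x powr (3/2)"
proof -
  define G where "G = F Q R"
  have cu: "continuous_on UNIV (\<lambda>x. u x powr s)" for s
    using u(2) by (intro continuous_intros u(1)) (auto simp: less_imp_neq[symmetric])
  have nz: "u x \<noteq> 0" "weight Q R x \<noteq> 0" for x
    using u(2)[of x] weight_pos[of Q R x] by auto
  show L: "L > 0" unfolding L_def using nz by (intro circ_integral_pos cu) simp
  have G: "G > 0" unfolding G_def F_def weighted_mean_def
    using u(2) nz by (intro circ_integral_pos continuous_intros u continuous_weight_powr) simp
  then show "F Q R > 0" by (simp add: G_def)
  define X where "X x = u x * weight Q R x powr (-5/2) / G" for x
  define Y where "Y x = u x powr (-2/3) / L" for x
  have XY: "X x > 0" "Y x > 0" for x
    using u(2)[of x] nz[of x] G L by (simp_all add: X_def Y_def)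
  define p q where "p x = X x powr (1/5)" and "q x = Y x powr (1/5)" for x
  have pq: "p x > 0" "q x > 0" for x using XY[of x] by (simp_all add: p_def q_def)
  have pq5: "p x ^ 5 = X x" "q x ^ 5 = Y x" for x
    using XY[of x] pq[of x] by (simp_all add: p_def q_def powr_power powr_numeral)
  \<comment> \<open>The upper bound in Hoelder's inequality; the claim amounts to
    \<open>2 pi \<le> c\<close>.\<close>
  define c where "c = G powr (2/5) * L powr (3/5)"
  have c: "c > 0" using G L by (simp add: c_def)
  have c5: "c ^ 5 = G\<^sup>2 * L ^ 3"
  proof -
    have "(G powr (2/5)) ^ 5 = G\<^sup>2" "(L powr (3/5)) ^ 5 = L ^ 3"
      using G L by (simp_all add: powr_power powr_numeral)
    then show ?thesis by (simp add: c_def power_mult_distrib)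
  qed
  have mix: "p x ^ 2 * q x ^ 3 = 1 / weight Q R x / c" for x
  proof -
    have "p x ^ 2 = X x powr (2/5)" "q x ^ 3 = Y x powr (3/5)"
      using XY[of x] pq[of x] by (simp_all add: p_def q_def powr_power powr_numeral)
    moreover have "X x powr (2/5) = u x powr (2/5) * weight Q R x powr (-1) / G powr (2/5)"
      using u(2)[of x] weight_pos[of Q R x] G by (simp add: X_def powr_divide powr_mult powr_powr)
    moreover have "Y x powr (3/5) = u x powr (-(2/5)) / L powr (3/5)"
      using u(2)[of x] L by (simp add: Y_def powr_divide powr_powr)
    ultimately have "p x ^ 2 * q x ^ 3 = (u x powr (2/5) * u x powr (-(2/5))) * weight Q R x powr (-1) / c"
      by (simp add: c_def)
    also have "u x powr (2/5) * u x powr (-(2/5)) = 1"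
      using nz[of x] by (simp add: powr_add[symmetric])
    finally show ?thesis
      using weight_pos[of Q R x] by (simp add: powr_minus divide_inverse)
  qed
  have cX: "continuous_on UNIV X" and cY: "continuous_on UNIV Y"
    unfolding X_def Y_def using G L
    by (auto intro!: continuous_intros u(1) continuous_weight_powr cu)
  have cp: "continuous_on UNIV p" "continuous_on UNIV q"
    unfolding p_def q_def using XY by (auto intro!: continuous_intros cX cY simp: less_imp_neq[symmetric])
  have iX: "(\<integral>x. X x \<partial>circ) = 1"
    using G unfolding X_def by (simp add: G_def F_def weighted_mean_def)
  have iY: "(\<integral>x. Y x \<partial>circ) = 1"
    using L unfolding Y_def by (simp add: L_def)
  have imix: "(\<integral>x. p x ^ 2 * q x ^ 3 \<partial>circ) = 2 * pi / c"
    by (simp only: mix integral_divide_zero circ_integral_inverse_weight)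
  \<comment> \<open>The pointwise defect in Young's inequality. It is continuous and nonnegative, so
    a vanishing integral forces it to vanish at every point of the period.\<close>
  define D where "D x = 2 * p x ^ 5 + 3 * q x ^ 5 - 5 * (p x)\<^sup>2 * q x ^ 3" for x
  have cD: "continuous_on UNIV D" unfolding D_def by (intro continuous_intros cp)
  have D0: "D x \<ge> 0" for x unfolding D_def using Young_2_3(1)[OF pq] by simp
  have iD: "(\<integral>x. D x \<partial>circ) = 5 - 5 * (2 * pi / c)"
  proof -
    have "(\<integral>x. D x \<partial>circ) = (\<integral>x. 2 * X x + 3 * Y x - 5 * (p x ^ 2 * q x ^ 3) \<partial>circ)"
      by (simp add: D_def pq5 mult.assoc)
    also have "\<dots> = 2 * (\<integral>x. X x \<partial>circ) + 3 * (\<integral>x. Y x \<partial>circ) - 5 * (\<integral>x. p x ^ 2 * q x ^ 3 \<partial>circ)"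
    proof -
      have "integrable circ X" "integrable circ Y" "integrable circ (\<lambda>x. p x ^ 2 * q x ^ 3)"
        by (intro integrable_circ_continuous_UNIV continuous_intros cX cY cp)+
      then show ?thesis by simp
    qed
    finally show ?thesis by (simp only: iX iY imix)
  qed
  have "(\<integral>x. D x \<partial>circ) \<ge> 0" using D0 by simp
  then have c_ge: "2 * pi \<le> c" unfolding iD using c by (simp add: field_simps)
  then have "(2 * pi) ^ 5 \<le> c ^ 5" by (intro power_mono) auto
  then show "(2 * pi) ^ 5 \<le> (F Q R)\<^sup>2 * L ^ 3" unfolding c5 G_def .
  assume eq: "(F Q R)\<^sup>2 * L ^ 3 = (2 * pi) ^ 5" and x: "x \<in> {0..2*pi}"
  have "c ^ 5 = (2 * pi) ^ 5" using eq c5 by (simp add: G_def)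
  then have "c = 2 * pi" using c power_eq_iff_eq_base[of 5 c "2 * pi"] by simp
  then have "(\<integral>x. D x \<partial>circ) = 0" unfolding iD by simp
  then have "AE x in circ. D x = 0"
    using integral_nonneg_eq_0_iff_AE[OF integrable_circ_continuous_UNIV[OF cD]] D0 by simp
  then have "D x = 0"
    using AE_circ_continuous_eq[OF cD continuous_on_const _ x, of 0] by simp
  then have "p x = q x" unfolding D_def using Young_2_3(2)[OF pq] by simp
  then have "X x = Y x" using pq5[of x] by simp
  then have "u x * weight Q R x powr (-5/2) = (G / L) * u x powr (-2/3)"
    using G L unfolding X_def Y_def by (simp add: field_simps)
  \<comment> \<open>Solving \<open>X x = Y x\<close> for \<open>u x\<close>: clearing the negative
    powers leaves \<open>u^(5/3) = (G / L) W^(5/2)\<close>, and the power \<open>3/5\<close> gives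
    the formula.\<close>
  then have "(u x * weight Q R x powr (-5/2)) * (weight Q R x powr (5/2) * u x powr (2/3))
     = ((G / L) * u x powr (-2/3)) * (weight Q R x powr (5/2) * u x powr (2/3))"
    by (rule arg_cong)
  then have "u x * (weight Q R x powr (-5/2) * weight Q R x powr (5/2)) * u x powr (2/3)
     = (G / L) * (u x powr (-2/3) * u x powr (2/3)) * weight Q R x powr (5/2)"
    by (simp only: mult_ac)
  then have "u x powr 1 * u x powr (2/3) = (G / L) * weight Q R x powr (5/2)"
    using nz[of x] u(2)[of x] by (simp add: powr_add[symmetric])
  then have "u x powr (5/3) = (G / L) * weight Q R x powr (5/2)"
    by (simp only: powr_add[symmetric]) simp
  then have "(u x powr (5/3)) powr (3/5) = ((G / L) * weight Q R x powr (5/2)) powr (3/5)" by simp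
  also have "((G / L) * weight Q R x powr (5/2)) powr (3/5) = (G / L) powr (3/5) * (weight Q R x powr (5/2)) powr (3/5)"
    using G L by (subst powr_mult) auto
  finally show "u x = (F Q R / L) powr (3/5) * weight Q R x powr (3/2)"
    using u(2)[of x] by (simp add: powr_powr G_def)
qed

section \<open>The shape and the curvature of the extremals\<close>

lemma circle_fun_eqI:
  assumes "circle_fun f" "circle_fun g" "\<And>x. x \<in> {0..2*pi} \<Longrightarrow> f x = g x"
  shows "f x = g x"
proof -
  have per: "h (y + of_int n * (2 * pi)) = h y" if "circle_fun h" for h y n
  proof (induction n rule: int_induct[of _ 0])
    case (step1 i)
    then show ?case using that[unfolded circle_fun_def, rule_format, of "y + of_int i * (2 * pi)"]
      by (simp add: algebra_simps)
  next
    case (step2 i)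
    then show ?case using that[unfolded circle_fun_def, rule_format, of "y + of_int (i - 1) * (2 * pi)"]
      by (simp add: algebra_simps)
  qed simp
  define n where "n = \<lfloor>x / (2 * pi)\<rfloor>"
  define y where "y = x - of_int n * (2 * pi)"
  have "of_int n \<le> x / (2 * pi)" "x / (2 * pi) < of_int n + 1"
    unfolding n_def by linarith+
  then have "y \<in> {0..2*pi}" unfolding y_def
    using pi_gt_zero by (auto simp: pos_le_divide_eq pos_divide_less_eq algebra_simps)
  then have "f y = g y" by (rule assms)
  moreover have "x = y + of_int n * (2 * pi)" by (simp add: y_def)
  ultimately show ?thesis using per[OF assms(1)] per[OF assms(2)] by simp
qed

text \<open>Such a function is \<open>c \<rho>^3\<close>, so its metric is a constant multiple of
  the pullback of the standard one by \<open>conf_theta\<close>. Concretely, the equation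
  \<open>\<rho>'' + \<rho> = 1 / \<rho>^3\<close> reduces the fourth-order expression to
  \<open>c / \<rho>^5\<close>, and the factor \<open>(c \<rho>^3)^(5/3)\<close> cancels the power of
  \<open>\<rho>\<close>, leaving \<open>c^(8/3)\<close>.\<close>

lemma constant_Q_curvature_extremal:
  assumes c: "c > 0"
  shows "constant_Q_curvature (\<lambda>x. c * weight Q R x powr (3/2))"
proof -
  obtain q r where w: "\<And>x. weight Q R x = (conf_rho q r x)\<^sup>2" using weight_eq_conf_rho[of Q R] by blast
  define \<rho> \<sigma> where "\<rho> = conf_rho q r" and "\<sigma> = conf_sigma q r"
  have pos: "\<rho> x > 0" for x by (simp add: \<rho>_def conf_rho_pos)
  then have nz: "\<rho> x \<noteq> 0" for x by (simp add: less_imp_neq[symmetric])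
  have d\<rho>: "(\<rho> has_real_derivative \<sigma> x) (at x)" for x
    unfolding \<rho>_def \<sigma>_def by (rule conf_rho_deriv)
  have d\<sigma>: "(\<sigma> has_real_derivative (1 / \<rho> x ^ 3 - \<rho> x)) (at x)" for x
    unfolding \<rho>_def \<sigma>_def by (rule conf_sigma_deriv)
  define u0 u1 u2 u3 u4 where "u0 x = c * \<rho> x ^ 3"
    and "u1 x = c * (3 * (\<rho> x)\<^sup>2 * \<sigma> x)"
    and "u2 x = c * (6 * \<rho> x * (\<sigma> x)\<^sup>2 + 3 / \<rho> x - 3 * \<rho> x ^ 3)"
    and "u3 x = c * (6 * \<sigma> x ^ 3 + 9 * \<sigma> x / (\<rho> x)\<^sup>2 - 21 * (\<rho> x)\<^sup>2 * \<sigma> x)"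
    and "u4 x = c * (- 60 * \<rho> x * (\<sigma> x)\<^sup>2 + 9 / \<rho> x ^ 5 - 30 / \<rho> x + 21 * \<rho> x ^ 3)" for x
  have d: "(u0 has_real_derivative u1 x) (at x)" "(u1 has_real_derivative u2 x) (at x)"
    "(u2 has_real_derivative u3 x) (at x)" "(u3 has_real_derivative u4 x) (at x)" for x
    unfolding u0_def u1_def u2_def u3_def u4_def using nz[of x]
    by (auto intro!: derivative_eq_intros d\<rho> d\<sigma> simp: field_simps eval_nat_numeral)
  have u: "(\<lambda>x. c * weight Q R x powr (3/2)) = u0"
  proof
    fix x
    have "(\<rho> x)\<^sup>2 = \<rho> x powr 2" using pos[of x] by (simp add: powr_numeral)
    then have "(\<rho> x)\<^sup>2 powr (3/2) = (\<rho> x powr 2) powr (3/2)" by (rule arg_cong)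
    also have "\<dots> = \<rho> x powr (2 * (3/2))" by (rule powr_powr)
    also have "\<dots> = \<rho> x ^ 3" using pos[of x] by (simp add: powr_numeral)
    finally show "c * weight Q R x powr (3/2) = u0 x" by (simp add: w u0_def \<rho>_def)
  qed
  have e: "deriv u0 = u1" "deriv u1 = u2" "deriv u2 = u3" "deriv u3 = u4"
    by (intro ext DERIV_imp_deriv d)+
  have mem: "(deriv ^^ k) u0 \<in> {u0, u1, u2, u3}" if "k < 4" for k
  proof -
    have "k = 0 \<or> k = 1 \<or> k = 2 \<or> k = 3" using that by linarith
    then show ?thesis by (auto simp: e eval_nat_numeral)
  qed
  have ex: "\<exists>D. (u0 has_real_derivative D) (at x)" "\<exists>D. (u1 has_real_derivative D) (at x)"
    "\<exists>D. (u2 has_real_derivative D) (at x)" "\<exists>D. (u3 has_real_derivative D) (at x)" for x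
    using d by blast+
  have diff: "(deriv ^^ k) u0 differentiable (at x)" if "k < 4" for k x
  proof -
    from mem[OF that] have "(deriv ^^ k) u0 = u0 \<or> (deriv ^^ k) u0 = u1 \<or> (deriv ^^ k) u0 = u2 \<or> (deriv ^^ k) u0 = u3"
      by blast
    then show ?thesis by (elim disjE) (simp_all only: ex real_differentiable_def)
  qed
  have "Q_curvature u0 x = c powr (8/3)" for x
  proof -
    have "1/9 * u4 x + 10/9 * u2 x + u0 x = c * \<rho> x powr (-5)"
    proof -
      have "1/9 * u4 x + 10/9 * u2 x + u0 x = c * (1 / \<rho> x ^ 5)"
        unfolding u4_def u2_def u0_def using nz[of x] by (simp add: field_simps eval_nat_numeral)
      then show ?thesis by (simp only: powr_minus_divide powr_numeral less_imp_le[OF pos])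
    qed
    moreover have "u0 x powr (5/3) = c powr (5/3) * \<rho> x powr 5"
    proof -
      have "u0 x = c * \<rho> x powr 3" using pos[of x] by (simp add: u0_def powr_numeral)
      then have "u0 x powr (5/3) = c powr (5/3) * (\<rho> x powr 3) powr (5/3)"
        using c by (simp only:, subst powr_mult) auto
      also have "(\<rho> x powr 3) powr (5/3) = \<rho> x powr (3 * (5/3))" by (rule powr_powr)
      finally show ?thesis by simp
    qed
    moreover have "(deriv ^^ 4) u0 = u4" "(deriv ^^ 2) u0 = u2" by (simp_all add: e eval_nat_numeral)
    ultimately have "Q_curvature u0 x = (c powr (5/3) * \<rho> x powr 5) * (c * \<rho> x powr (-5))"
      by (simp only: Q_curvature_def)
    also have "\<dots> = c powr (5/3) * c powr 1 * (\<rho> x powr 5 * \<rho> x powr (-5))"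
      using c by (simp only: powr_one mult_ac less_imp_le)
    also have "\<dots> = c powr (8/3)" using nz[of x] by (simp only: powr_add[symmetric]) simp
    finally show ?thesis .
  qed
  then show ?thesis unfolding u constant_Q_curvature_def using diff by blast
qed

text \<open>Diagonalisation of the quadratic form: its eigenvalues \<open>P + K\<close> and
  \<open>P - K\<close> have product 1, so they are \<open>l^2\<close> and \<open>1 / l^2\<close>,
  and the eigenvectors are orthogonal.\<close>

lemma weight_diagonal:
  obtains l \<beta> where "l > 0" "\<beta> \<in> {0..<2 * pi}"
    "\<And>x. weight Q R x = l\<^sup>2 * (cos (x - \<beta>))\<^sup>2 + (1 / l\<^sup>2) * (sin (x - \<beta>))\<^sup>2"
proof -
  define P where "P = conf_p Q R"
  define K where "K = sqrt (Q\<^sup>2 + R\<^sup>2)"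
  have P2: "P\<^sup>2 = 1 + K\<^sup>2" unfolding P_def K_def by (simp add: conf_p_square)
  have K0: "K \<ge> 0" by (simp add: K_def)
  have P0: "P > 0" by (simp add: P_def conf_p_pos)
  \<comment> \<open>The signs absorb those in \<open>weight\<close>, so that
    \<open>\<phi> / 2\<close> is the direction of the larger eigenvalue.\<close>
  obtain \<phi> where \<phi>: "0 \<le> \<phi>" "\<phi> < 2 * pi" "- Q = K * cos \<phi>" "- R = K * sin \<phi>"
    using polar_coordinates[of "- Q" "- R"] unfolding K_def by auto
  define l where "l = sqrt (P + K)"
  have l: "l > 0" "l\<^sup>2 = P + K" using P0 K0 by (simp_all add: l_def)
  have l': "1 / l\<^sup>2 = P - K"
  proof -
    have "(P - K) * (P + K) = 1" using P2 by (simp add: algebra_simps power2_eq_square)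
    then show ?thesis unfolding l(2) using P0 K0 by (simp add: field_simps)
  qed
  have "weight Q R x = l\<^sup>2 * (cos (x - \<phi> / 2))\<^sup>2 + (1 / l\<^sup>2) * (sin (x - \<phi> / 2))\<^sup>2" for x
  proof -
    define t where "t = x - \<phi> / 2"
    have "weight Q R x = P + K * (cos (2 * x) * cos \<phi> + sin (2 * x) * sin \<phi>)"
    proof -
      have "Q = - (K * cos \<phi>)" "R = - (K * sin \<phi>)" using \<phi>(3,4) by linarith+
      then show ?thesis unfolding weight_def P_def[symmetric] by (simp add: algebra_simps)
    qed
    also have "cos (2 * x) * cos \<phi> + sin (2 * x) * sin \<phi> = cos (2 * t)"
    proof -
      have "2 * t = 2 * x - \<phi>" by (simp add: t_def)
      then show ?thesis by (simp only: cos_diff)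
    qed
    also have "P + K * cos (2 * t) = P * ((cos t)\<^sup>2 + (sin t)\<^sup>2) + K * ((cos t)\<^sup>2 - (sin t)\<^sup>2)"
      by (simp add: cos_double)
    also have "\<dots> = l\<^sup>2 * (cos t)\<^sup>2 + (1 / l\<^sup>2) * (sin t)\<^sup>2"
      unfolding l' unfolding l(2) by algebra
    finally show ?thesis by (simp add: t_def)
  qed
  then show ?thesis using that[of l "\<phi> / 2"] l(1) \<phi>(1,2) by auto
qed

lemma energy_ge_weighted_mean:
  assumes u: "u \<in> H2_circle" "\<And>x. u x > 0"
  obtains Q R where "energy u \<ge> 9 / (2 * pi) * (weighted_mean u Q R)\<^sup>2"
proof -
  obtain g1 g2 where g: "circle_H2 u g1 g2" "energy u = energy3 u g1 g2"
    using H2_circle_energy[OF u(1)] by blast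
  have cu: "continuous_on UNIV u" using u(1) by (simp add: H2_circle_def)
  obtain Q R where min: "\<forall>Q' R'. weighted_mean u Q R \<le> weighted_mean u Q' R'"
    using weighted_mean_attains_min[of u] cu u(2) by blast
  have "energy3 u g1 g2 \<ge> 9 / (2 * pi) * (weighted_mean u Q R)\<^sup>2"
    using min weighted_mean_Hoelder(2)[OF cu u(2), of Q R]
    by (intro energy3_ge_weighted_mean[OF g(1)] u(2)) auto
  then show ?thesis using that[of Q R] g(2) by simp
qed

theorem theorem2:
  shows "(\<forall>u \<in> H2_circle.
      (\<forall>\<theta>. u \<theta> > 0) \<longrightarrow>
      (\<forall>\<alpha>\<in>{0..<2 * pi}. (LBINT \<theta>:{0..2 * pi}. cos (\<theta> + \<alpha>) ^ 3 / u \<theta> powr (5/3)) = 0) \<longrightarrow>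
      energy u * (LBINT \<theta>:{0..2 * pi}. u \<theta> powr (-2/3)) ^ 3 \<ge> 144 * pi ^ 4)
    \<and> (\<forall>u\<^sub>0 \<in> H2_circle.
      (\<forall>\<theta>. u\<^sub>0 \<theta> > 0) \<longrightarrow>
      (\<forall>\<alpha>\<in>{0..<2 * pi}. (LBINT \<theta>:{0..2 * pi}. cos (\<theta> + \<alpha>) ^ 3 * u\<^sub>0 \<theta> powr (-5/3)) = 0) \<longrightarrow>
      energy u\<^sub>0 * (LBINT \<theta>:{0..2 * pi}. u\<^sub>0 \<theta> powr (-2/3)) ^ 3 = 144 * pi ^ 4 \<longrightarrow>
      constant_Q_curvature u\<^sub>0 \<and>
      (\<exists>l>0. \<exists>c>0. \<exists>\<beta>\<in>{0..<2 * pi}. \<forall>\<theta>.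
         u\<^sub>0 \<theta> = c * (l\<^sup>2 * (cos (\<theta> - \<beta>))\<^sup>2 + (1 / l\<^sup>2) * (sin (\<theta> - \<beta>))\<^sup>2) powr (3/2)))"
proof -
  \<comment> \<open>Both links of the chain are kept with common parameters \<open>Q\<close>,
    \<open>R\<close>: if the product attains the constant, the middle term is squeezed and Hoelder's
    inequality holds with equality at these parameters.\<close>
  have main: "\<exists>Q R. 144 * pi ^ 4 \<le> 9 / (2 * pi) * ((weighted_mean u Q R)\<^sup>2 * L ^ 3) \<and>
      9 / (2 * pi) * ((weighted_mean u Q R)\<^sup>2 * L ^ 3) \<le> energy u * L ^ 3"
    if u: "u \<in> H2_circle" "\<And>x. u x > 0" and L: "L = (LBINT \<theta>:{0..2 * pi}. u \<theta> powr (-2/3))" for u L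
  proof -
    have cu: "continuous_on UNIV u" using u(1) by (simp add: H2_circle_def)
    obtain Q R where QR: "energy u \<ge> 9 / (2 * pi) * (weighted_mean u Q R)\<^sup>2"
      using energy_ge_weighted_mean[OF u] by blast
    note H = weighted_mean_Hoelder[OF cu u(2), folded set_integral_circ, folded L]
    have "144 * pi ^ 4 = 9 / (2 * pi) * (2 * pi) ^ 5"
      by (simp add: eval_nat_numeral)
    also have "\<dots> \<le> 9 / (2 * pi) * ((weighted_mean u Q R)\<^sup>2 * L ^ 3)"
      using H(3)[of Q R] by (intro mult_left_mono) auto
    finally have 1: "144 * pi ^ 4 \<le> 9 / (2 * pi) * ((weighted_mean u Q R)\<^sup>2 * L ^ 3)" .
    have "9 / (2 * pi) * (weighted_mean u Q R)\<^sup>2 * L ^ 3 \<le> energy u * L ^ 3"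
      using QR H(1) by (intro mult_right_mono) auto
    then show ?thesis using 1 by (intro exI[of _ Q] exI[of _ R]) (simp only: mult.assoc simp_thms)
  qed
  have ineq: "144 * pi ^ 4 \<le> energy u * (LBINT \<theta>:{0..2 * pi}. u \<theta> powr (-2/3)) ^ 3"
    if u: "u \<in> H2_circle" "\<forall>x. u x > 0" for u
    using main[of u, OF u(1) u(2)[rule_format] refl] order_trans by blast
  have rigid: "constant_Q_curvature u \<and>
      (\<exists>l>0. \<exists>c>0. \<exists>\<beta>\<in>{0..<2 * pi}. \<forall>\<theta>.
         u \<theta> = c * (l\<^sup>2 * (cos (\<theta> - \<beta>))\<^sup>2 + (1 / l\<^sup>2) * (sin (\<theta> - \<beta>))\<^sup>2) powr (3/2))"
    if u: "u \<in> H2_circle" "\<forall>x. u x > 0"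
      and eq: "energy u * (LBINT \<theta>:{0..2 * pi}. u \<theta> powr (-2/3)) ^ 3 = 144 * pi ^ 4" for u
  proof -
    define L where "L = (LBINT \<theta>:{0..2 * pi}. u \<theta> powr (-2/3))"
    have cu: "continuous_on UNIV u" and per: "circle_fun u"
      using u(1) by (auto simp: H2_circle_def L2_circle_def)
    have pos: "u x > 0" for x using u(2) by blast
    obtain Q R where QR: "144 * pi ^ 4 \<le> 9 / (2 * pi) * ((weighted_mean u Q R)\<^sup>2 * L ^ 3)"
        "9 / (2 * pi) * ((weighted_mean u Q R)\<^sup>2 * L ^ 3) \<le> energy u * L ^ 3"
      using main[OF u(1) pos L_def] by blast
    note H = weighted_mean_Hoelder[OF cu pos, folded set_integral_circ, folded L_def]
    have "9 / (2 * pi) * ((weighted_mean u Q R)\<^sup>2 * L ^ 3) = 144 * pi ^ 4"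
      using QR eq unfolding L_def[symmetric] by linarith
    also have "\<dots> = 9 / (2 * pi) * (2 * pi) ^ 5"
      by (simp add: eval_nat_numeral)
    finally have FL: "(weighted_mean u Q R)\<^sup>2 * L ^ 3 = (2 * pi) ^ 5"
      by (simp only: mult_cancel_left) simp
    define c where "c = (weighted_mean u Q R / L) powr (3/5)"
    have c: "c > 0" using H(1) H(2)[of Q R] by (simp add: c_def)
    \<comment> \<open>Equality in Hoelder yields the formula on one period only; periodicity of both
      sides extends it to the line.\<close>
    have "u x = c * weight Q R x powr (3/2)" for x
    proof (rule circle_fun_eqI[OF per])
      show "circle_fun (\<lambda>x. c * weight Q R x powr (3/2))"
        by (simp add: circle_fun_def conf_periodic)
    qed (use H(4)[OF FL] in \<open>simp add: c_def\<close>)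
    then have ueq: "u = (\<lambda>x. c * weight Q R x powr (3/2))" by blast
    obtain l \<beta> where l: "l > 0" "\<beta> \<in> {0..<2 * pi}"
      "\<And>x. weight Q R x = l\<^sup>2 * (cos (x - \<beta>))\<^sup>2 + (1 / l\<^sup>2) * (sin (x - \<beta>))\<^sup>2"
      using weight_diagonal[of Q R] by blast
    have "constant_Q_curvature u" unfolding ueq by (rule constant_Q_curvature_extremal[OF c])
    moreover have "\<forall>\<theta>. u \<theta> = c * (l\<^sup>2 * (cos (\<theta> - \<beta>))\<^sup>2 + (1 / l\<^sup>2) * (sin (\<theta> - \<beta>))\<^sup>2) powr (3/2)"
      unfolding ueq l(3) by simp
    ultimately show ?thesis using l(1,2) c by blast
  qed
  show ?thesis using ineq rigid by blast
qed

end
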